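(* Let $n,d$ be integers with $4\leq d\leq n-2$, and let $G\in\mathcal{U}_{n,d}$. Then $SO_{red}(G)\leq SO_{red}(U_{n}^{d})$, with equality if and only if $G\cong U_{n}^{d}$.
   Context: All graphs are finite, simple and connected. For a graph $G$, $d_u=d_G(u)$ denotes the degree of the vertex $u$, and the reduced Sombor index is $$SO_{red}(G)=\sum_{uv\in E(G)}\sqrt{(d_{u}-1)^{2}+(d_{v}-1)^{2}}.$$ The diameter of $G$ is the maximum distance between two vertices of $G$. A unicyclic graph is a connected graph containing exactly one cycle (equivalently, a connected graph with as many edges as vertices). $\mathcal{U}_{n,d}$ denotes the set of unicyclic graphs with $n$ vertices and diameter $d$. For $4\leq d\leq n-2$, $U_n^d\in\mathcal{U}_{n,d}$ is the following graph: take a path $u_1u_2\cdots u_du_{d+1}$ on $d+1$ vertices, add a new vertex $w$ adjacent to exactly $u_2$ and $u_4$ (so that $u_2u_3u_4w$ is a 4-cycle), and attach $n-d-2$ further pendent vertices (vertices of degree 1) to $u_2$. Its reduced Sombor index is $$SO_{red}(U_{n}^{d})=(n-d-1)(n-d)+2\sqrt{(n-d)^{2}+1}+F_{2},$$ where $F_{2}=2\sqrt{5}+2$ if $d=4$ and $F_{2}=\sqrt{2}(d-5)+3\sqrt{5}+1$ if $d\geq 5$. *)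

theory Defs
  imports Complex_Main
begin

type_synonym 'a ugraph = "'a set \<times> 'a set set"

abbreviation gverts :: "'a ugraph \<Rightarrow> 'a set" where "gverts \<equiv> fst"
abbreviation gedges :: "'a ugraph \<Rightarrow> 'a set set" where "gedges \<equiv> snd"

definition simple_ugraph :: "'a ugraph \<Rightarrow> bool" where
  "simple_ugraph G \<longleftrightarrow> finite (gverts G) \<and>
     (\<forall>e\<in>gedges G. \<exists>u\<in>gverts G. \<exists>v\<in>gverts G. u \<noteq> v \<and> e = {u, v})"

definition gdegree :: "'a ugraph \<Rightarrow> 'a \<Rightarrow> nat" where
  "gdegree G v = card {e \<in> gedges G. v \<in> e}"

(* An edge e = {u, v} with u \<noteq> v contributes sqrt ((d_u - 1)^2 + (d_v - 1)^2);
   the inner sum ranges over its two endpoints. *)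
definition reduced_sombor :: "'a ugraph \<Rightarrow> real" where
  "reduced_sombor G = (\<Sum>e\<in>gedges G. sqrt (\<Sum>v\<in>e. (real (gdegree G v) - 1)\<^sup>2))"

definition gwalk :: "'a ugraph \<Rightarrow> 'a list \<Rightarrow> bool" where
  "gwalk G p \<longleftrightarrow> p \<noteq> [] \<and> set p \<subseteq> gverts G \<and> successively (\<lambda>u v. {u, v} \<in> gedges G) p"

definition gwalk_betw :: "'a ugraph \<Rightarrow> 'a \<Rightarrow> 'a list \<Rightarrow> 'a \<Rightarrow> bool" where
  "gwalk_betw G u p v \<longleftrightarrow> gwalk G p \<and> hd p = u \<and> last p = v"

definition gconnected :: "'a ugraph \<Rightarrow> bool" where
  "gconnected G \<longleftrightarrow> gverts G \<noteq> {} \<and>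
     (\<forall>u\<in>gverts G. \<forall>v\<in>gverts G. \<exists>p. gwalk_betw G u p v)"

(* The length of a walk is its number of edges, one less than the length of its vertex list. *)
definition gdistance :: "'a ugraph \<Rightarrow> 'a \<Rightarrow> 'a \<Rightarrow> nat" where
  "gdistance G u v = (LEAST k. \<exists>p. gwalk_betw G u p v \<and> length p = Suc k)"

definition gdiameter :: "'a ugraph \<Rightarrow> nat" where
  "gdiameter G = Max {gdistance G u v | u v. u \<in> gverts G \<and> v \<in> gverts G}"

(* A cycle is a subgraph, so it is identified with its edge set; vertex lists that differ by
   rotation or reversal describe the same cycle. *)
definition gcycle :: "'a ugraph \<Rightarrow> 'a set set \<Rightarrow> bool" where
  "gcycle G C \<longleftrightarrow> C \<subseteq> gedges G \<and>
     (\<exists>p. distinct p \<and> 3 \<le> length p \<and>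
          C = {{p ! i, p ! (Suc i mod length p)} | i. i < length p})"

definition unicyclic :: "'a ugraph \<Rightarrow> bool" where
  "unicyclic G \<longleftrightarrow> simple_ugraph G \<and> gconnected G \<and> (\<exists>!C. gcycle G C)"

definition unicyclic_class :: "nat \<Rightarrow> nat \<Rightarrow> 'a ugraph set" where
  "unicyclic_class n d = {G. unicyclic G \<and> card (gverts G) = n \<and> gdiameter G = d}"

definition giso :: "'a ugraph \<Rightarrow> 'b ugraph \<Rightarrow> bool" where
  "giso G H \<longleftrightarrow> (\<exists>f. bij_betw f (gverts G) (gverts H) \<and>
     (\<forall>u\<in>gverts G. \<forall>v\<in>gverts G. {u, v} \<in> gedges G \<longleftrightarrow> {f u, f v} \<in> gedges H))"

(* Meant for 4 \<le> d and d + 2 \<le> n. The vertex i with 1 \<le> i \<le> d + 1 is u_i, the vertex d + 2 is w,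
   and d + 3, ..., n are the n - d - 2 further pendent vertices attached to u_2. *)
definition U_graph :: "nat \<Rightarrow> nat \<Rightarrow> nat ugraph" where
  "U_graph n d =
     ({1..n},
      {{i, Suc i} | i. i \<in> {1..d}} \<union> {{d + 2, 2}, {d + 2, 4}} \<union> {{2, j} | j. j \<in> {d + 3..n}})"

end

(* Let x_v = d_v - 1. For an edge e = uv put fd(x_u, x_v) = x_u + x_v - sqrt(x_u^2 + x_v^2), its
   defect; it vanishes when e has a leaf as an end and is at least c = fd(1, 1) = 2 - sqrt 2 otherwise.
   Summing x_u + x_v over the edges gives the sum of d_v x_v over the vertices, so SO_red is a quadratic
   expression in the excesses y_v = d_v - 2 of the non-leaves minus the total defect. The sum of the y_v
   is fixed by the number of edges (at most n) and of non-leaves. A diametral path together with a cycle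
   vertex w outside it gives at least d non-leaves. If there are more, or if the excess is not split as
   n - d - 1 and 1 over two vertices, then the quadratic part already loses more than the defects of
   U_n^d exceed c. Otherwise the non-leaves are w and the inner vertices of the path, w has exactly two
   neighbours u_p, u_q with |p - q| <= 2, these carry the excess, and the few remaining positions of
   p and q are compared through the defects of the edges near them. *)
theory Submission
  imports Defs
begin

section \<open>Finite simple graphs\<close>

lemma simple_ugraph_edgeD:
  assumes "simple_ugraph G" "{u, v} \<in> gedges G"
  shows "u \<in> gverts G" "v \<in> gverts G" "u \<noteq> v"
  using assms unfolding simple_ugraph_def by (fastforce simp: doubleton_eq_iff)+

lemma simple_ugraph_edgeE:
  assumes "simple_ugraph G" "e \<in> gedges G"
  obtains u v where "u \<in> gverts G" "v \<in> gverts G" "u \<noteq> v" "e = {u, v}"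
  using assms unfolding simple_ugraph_def by blast

lemma finite_gverts: "simple_ugraph G \<Longrightarrow> finite (gverts G)"
  by (simp add: simple_ugraph_def)

lemma finite_gedges:
  assumes "simple_ugraph G"
  shows "finite (gedges G)"
proof (rule finite_subset)
  show "gedges G \<subseteq> Pow (gverts G)" using assms by (auto elim!: simple_ugraph_edgeE)
qed (use assms in \<open>simp add: finite_gverts\<close>)

definition nbrs :: "'a ugraph \<Rightarrow> 'a \<Rightarrow> 'a set" where
  "nbrs G v = {x. {v, x} \<in> gedges G}"

lemma nbrs_subset: "simple_ugraph G \<Longrightarrow> nbrs G v \<subseteq> gverts G - {v}"
  using simple_ugraph_edgeD[of G v] by (auto simp: nbrs_def)

lemma finite_nbrs: "simple_ugraph G \<Longrightarrow> finite (nbrs G v)"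
  by (meson finite_Diff finite_gverts finite_subset nbrs_subset)

lemma gdegree_eq_card_nbrs:
  assumes "simple_ugraph G"
  shows "gdegree G v = card (nbrs G v)"
proof -
  have "bij_betw (\<lambda>x. {v, x}) (nbrs G v) {e \<in> gedges G. v \<in> e}"
    unfolding bij_betw_def
  proof
    show "inj_on (\<lambda>x. {v, x}) (nbrs G v)"
      by (auto simp: inj_on_def doubleton_eq_iff)
    show "(\<lambda>x. {v, x}) ` nbrs G v = {e \<in> gedges G. v \<in> e}"
    proof (intro equalityI subsetI)
      fix e assume "e \<in> {e \<in> gedges G. v \<in> e}"
      then have e: "e \<in> gedges G" "v \<in> e" by auto
      obtain a b where "e = {a, b}" using simple_ugraph_edgeE[OF assms e(1)] by metis
      then obtain x where "e = {v, x}" using e(2) by auto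
      then show "e \<in> (\<lambda>x. {v, x}) ` nbrs G v" using e by (auto simp: nbrs_def)
    qed (auto simp: nbrs_def)
  qed
  then show ?thesis unfolding gdegree_def by (metis bij_betw_same_card)
qed

lemma card_le_gdegree:
  assumes "simple_ugraph G" "A \<subseteq> nbrs G v"
  shows "card A \<le> gdegree G v"
  using assms by (simp add: gdegree_eq_card_nbrs card_mono finite_nbrs)

lemma two_le_gdegree:
  assumes "simple_ugraph G" "{v, a} \<in> gedges G" "{v, b} \<in> gedges G" "a \<noteq> b"
  shows "2 \<le> gdegree G v"
  using card_le_gdegree[OF assms(1), of "{a, b}" v] assms by (simp add: nbrs_def)

lemma three_le_gdegree:
  assumes "simple_ugraph G" "{v, a} \<in> gedges G" "{v, b} \<in> gedges G" "{v, c} \<in> gedges G"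
    "a \<noteq> b" "a \<noteq> c" "b \<noteq> c"
  shows "3 \<le> gdegree G v"
  using card_le_gdegree[OF assms(1), of "{a, b, c}" v] assms by (simp add: nbrs_def)

text \<open>Double counting of incidences. With \<open>h = 1\<close> it is the handshake lemma; with
  degree minus 1 for \<open>h\<close> it evaluates the part of the index that is linear along
  edges.\<close>

lemma sum_edges_eq_sum_degrees:
  fixes h :: "'a \<Rightarrow> real"
  assumes "simple_ugraph G"
  shows "(\<Sum>e\<in>gedges G. \<Sum>v\<in>e. h v) = (\<Sum>v\<in>gverts G. real (gdegree G v) * h v)"
proof -
  have "(\<Sum>e\<in>gedges G. \<Sum>v\<in>e. h v) = (\<Sum>e\<in>gedges G. \<Sum>v\<in>{v \<in> gverts G. v \<in> e}. h v)"
    using assms by (intro sum.cong refl) (auto elim!: simple_ugraph_edgeE)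
  also have "\<dots> = (\<Sum>v\<in>gverts G. \<Sum>e\<in>{e \<in> gedges G. v \<in> e}. h v)"
    using assms by (intro sum.swap_restrict) (auto simp: finite_gverts finite_gedges)
  finally show ?thesis by (simp add: gdegree_def)
qed

section \<open>Cycles and the number of edges\<close>

lemma gcycle_mono: "gcycle H C \<Longrightarrow> gedges H \<subseteq> gedges G \<Longrightarrow> gcycle G C"
  unfolding gcycle_def by blast

text \<open>In a longest path all neighbours of the first vertex lie on the path; a neighbour other
  than the second vertex closes a cycle with the initial segment up to it.\<close>

lemma exists_gcycle_if_gdegree_ge_2:
  assumes G: "simple_ugraph G" and ne: "gverts G \<noteq> {}"
    and deg: "\<And>v. v \<in> gverts G \<Longrightarrow> 2 \<le> gdegree G v"
  shows "\<exists>C. gcycle G C"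
proof -
  define Q where "Q p \<longleftrightarrow> distinct p \<and> gwalk G p" for p
  obtain v0 where v0: "v0 \<in> gverts G" using ne by blast
  have Q0: "Q [v0]" using v0 by (simp add: Q_def gwalk_def)
  have bound: "length p \<le> card (gverts G)" if "Q p" for p
    using that finite_gverts[OF G] unfolding Q_def gwalk_def
    by (metis card_mono distinct_card)
  obtain p where p: "Q p" and max: "\<And>q. Q q \<Longrightarrow> length q \<le> length p"
    using ex_has_greatest_nat[of Q "[v0]" length "Suc (card (gverts G))"] Q0 bound
    by (metis le_imp_less_Suc)
  have pne: "p \<noteq> []" and dist: "distinct p" and sub: "set p \<subseteq> gverts G"
    and succ: "successively (\<lambda>u v. {u, v} \<in> gedges G) p"
    using p by (auto simp: Q_def gwalk_def)
  obtain h t where ht: "p = h # t" using pne by (cases p) auto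
  have nb: "nbrs G h \<subseteq> set p"
  proof
    fix x assume x: "x \<in> nbrs G h"
    show "x \<in> set p"
    proof (rule ccontr)
      assume "x \<notin> set p"
      moreover have "x \<in> gverts G" using x nbrs_subset[OF G] by blast
      ultimately have "Q (x # p)"
        using x dist sub succ ht by (auto simp: Q_def gwalk_def nbrs_def insert_commute)
      then show False using max by fastforce
    qed
  qed
  have "2 \<le> card (nbrs G h)" using deg[of h] sub ht by (simp add: gdegree_eq_card_nbrs[OF G])
  \<comment> \<open>For a path of length 1 the term \<open>p ! 1\<close> is an unspecified value.
    This is harmless: a singleton cannot contain two neighbours, and \<open>x\<close> is then
    located at an index other than 0 and 1 in any case.\<close>
  then have "\<not> nbrs G h \<subseteq> {p ! 1}" using card_mono[of "{p ! 1}" "nbrs G h"] by auto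
  then obtain x where x: "x \<in> nbrs G h" "x \<noteq> p ! 1" by blast
  then obtain j where j: "j < length p" "p ! j = x" using nb by (metis in_set_conv_nth subsetD)
  have "x \<noteq> h" using x nbrs_subset[OF G] by blast
  then have "j \<noteq> 0" "j \<noteq> 1" using j(2) x(2) ht by (metis nth_Cons_0, metis)
  then have j2: "2 \<le> j" by simp
  define q where "q = take (Suc j) p"
  have lq: "length q = Suc j" using j by (simp add: q_def)
  have step: "{q ! i, q ! (Suc i mod length q)} \<in> gedges G" if "i < length q" for i
  proof (cases "i = j")
    case True
    then have "Suc i mod length q = 0" using lq by simp
    moreover have "q ! 0 = h" "q ! j = x" using j(2) ht by (simp_all add: q_def del: take_Suc_Cons)
    ultimately show ?thesis using True x by (simp add: nbrs_def insert_commute)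
  next
    case False
    then have "Suc i mod length q = Suc i" "i < j" using that lq by auto
    then show ?thesis using succ j unfolding successively_conv_nth q_def by simp
  qed
  have "gcycle G {{q ! i, q ! (Suc i mod length q)} | i. i < length q}"
    unfolding gcycle_def
  proof (intro conjI exI[of _ q])
    show "distinct q" using dist by (simp add: q_def)
  qed (use step lq j2 in auto)
  then show ?thesis by blast
qed

text \<open>Deleting a vertex of degree at most 1 removes at most one edge, so the inequality
  survives until every degree is at least 2.\<close>

lemma exists_gcycle_if_card_le:
  assumes "simple_ugraph G" "gverts G \<noteq> {}" "card (gverts G) \<le> card (gedges G)"
  shows "\<exists>C. gcycle G C"
  using assms
proof (induction "card (gverts G)" arbitrary: G rule: less_induct)
  case less
  note G = less.prems(1)
  show ?case
  proof (cases "\<forall>v\<in>gverts G. 2 \<le> gdegree G v")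
    case True
    then show ?thesis using exists_gcycle_if_gdegree_ge_2 less.prems by blast
  next
    case False
    then obtain v where v: "v \<in> gverts G" "gdegree G v \<le> 1" by fastforce
    define H where "H = (gverts G - {v}, {e \<in> gedges G. v \<notin> e})"
    have H: "simple_ugraph H" unfolding simple_ugraph_def
    proof (intro conjI ballI)
      show "finite (gverts H)" using finite_gverts[OF G] by (simp add: H_def)
      fix e assume "e \<in> gedges H"
      then have "e \<in> gedges G" "v \<notin> e" by (auto simp: H_def)
      then obtain a b where "a \<in> gverts G" "b \<in> gverts G" "a \<noteq> b" "e = {a, b}" "v \<notin> e"
        using simple_ugraph_edgeE[OF G] by metis
      then show "\<exists>a\<in>gverts H. \<exists>b\<in>gverts H. a \<noteq> b \<and> e = {a, b}" by (auto simp: H_def)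
    qed
    have ne: "gverts H \<noteq> {}"
    proof
      assume "gverts H = {}"
      then have "gverts G = {v}" using v by (auto simp: H_def)
      then have "gedges G = {}" using simple_ugraph_edgeE[OF G] by (metis equals0I singletonD)
      then show False using less.prems \<open>gverts G = {v}\<close> by simp
    qed
    have cE: "card (gedges G) = card (gedges H) + gdegree G v"
    proof -
      have "gedges H = gedges G - {e \<in> gedges G. v \<in> e}" by (auto simp: H_def)
      then have "card (gedges H) = card (gedges G) - gdegree G v"
        unfolding gdegree_def by (simp add: card_Diff_subset finite_gedges[OF G])
      moreover have "gdegree G v \<le> card (gedges G)"
        unfolding gdegree_def by (intro card_mono finite_gedges[OF G]) blast
      ultimately show ?thesis by linarith
    qed
    have cV: "card (gverts G) = Suc (card (gverts H))"
      using card_Suc_Diff1[OF finite_gverts[OF G] v(1)] by (simp add: H_def)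
    have "card (gverts H) \<le> card (gedges H)" using less.prems(3) v(2) cE cV by linarith
    then obtain C where "gcycle H C" using less.hyps[OF _ H ne] cV by auto
    then show ?thesis using gcycle_mono[of H C G] by (auto simp: H_def)
  qed
qed

text \<open>With more edges than vertices, deleting an edge of the cycle would leave enough edges
  for a second cycle. Only this inequality is kept; in the final bound a missing edge counts as a
  loss.\<close>

lemma card_gedges_le_if_unicyclic:
  assumes "unicyclic G"
  shows "card (gedges G) \<le> card (gverts G)"
proof (rule ccontr)
  assume contr: "\<not> ?thesis"
  have G: "simple_ugraph G" and ne: "gverts G \<noteq> {}" and ex1: "\<exists>!C. gcycle G C"
    using assms unfolding unicyclic_def gconnected_def by blast+
  obtain C where C: "gcycle G C" using ex1 by (rule ex1E)
  then have "C \<subseteq> gedges G" by (simp add: gcycle_def)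
  moreover obtain p where "3 \<le> length p" "C = {{p ! i, p ! (Suc i mod length p)} | i. i < length p}"
    using C unfolding gcycle_def by blast
  then have "{p ! 0, p ! (Suc 0 mod length p)} \<in> C" by force
  ultimately obtain e where e: "e \<in> C" "e \<in> gedges G" by blast
  define H where "H = (gverts G, gedges G - {e})"
  have "simple_ugraph H" using G unfolding simple_ugraph_def H_def by simp
  moreover have "card (gverts H) \<le> card (gedges H)"
    using contr e finite_gedges[OF G] by (simp add: H_def)
  ultimately obtain D where D: "gcycle H D"
    using exists_gcycle_if_card_le[of H] ne by (auto simp: H_def)
  then have "e \<notin> D" by (auto simp: gcycle_def H_def)
  moreover have "gcycle G D" using D gcycle_mono[of H D G] by (auto simp: H_def)
  ultimately show False using ex1 C e(1) by metis
qed

text \<open>Replaces the cyclic list by the one property used later: each vertex of the set has two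
  neighbours inside the set.\<close>

lemma gcycle_vertices:
  assumes "gcycle G C"
  obtains S where "S \<noteq> {}" "finite S"
    "\<And>v. v \<in> S \<Longrightarrow> \<exists>a\<in>S. \<exists>b\<in>S. a \<noteq> b \<and> {v, a} \<in> gedges G \<and> {v, b} \<in> gedges G"
proof -
  obtain p where p: "distinct p" "3 \<le> length p"
    and C: "{{p ! i, p ! (Suc i mod length p)} | i. i < length p} \<subseteq> gedges G"
    using assms unfolding gcycle_def by blast
  let ?l = "length p"
  have edge: "{p ! i, p ! (Suc i mod ?l)} \<in> gedges G" if "i < ?l" for i
    using that by (intro subsetD[OF C] CollectI exI[of _ i]) simp
  have "\<exists>a\<in>set p. \<exists>b\<in>set p. a \<noteq> b \<and> {v, a} \<in> gedges G \<and> {v, b} \<in> gedges G"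
    if v: "v \<in> set p" for v
  proof -
    obtain i where i: "i < ?l" "v = p ! i" using v by (metis in_set_conv_nth)
    \<comment> \<open>\<open>k\<close> is the cyclic predecessor of \<open>i\<close>. It differs
      from the cyclic successor because the cycle has length at least 3.\<close>
    define k where "k = (if i = 0 then ?l - 1 else i - 1)"
    have k: "k < ?l" "Suc k mod ?l = i" using i(1) p(2) by (auto simp: k_def)
    have l: "Suc i mod ?l < ?l" using i(1) by (intro mod_less_divisor) linarith
    have ne: "Suc i mod ?l \<noteq> k"
      using i(1) p(2) by (cases "Suc i = ?l") (auto simp: k_def)
    have "{v, p ! (Suc i mod ?l)} \<in> gedges G" using edge[OF i(1)] i by simp
    moreover have "{v, p ! k} \<in> gedges G" using edge[OF k(1)] k i by (simp add: insert_commute)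
    moreover have "p ! (Suc i mod ?l) \<noteq> p ! k"
      using ne l k p by (simp add: nth_eq_iff_index_eq)
    ultimately show ?thesis
      using l k by (intro bexI[of _ "p ! (Suc i mod ?l)"] bexI[of _ "p ! k"]) auto
  qed
  moreover have "set p \<noteq> {}" using p by auto
  ultimately show thesis by (intro that[of "set p"]) auto
qed

section \<open>Distances\<close>

lemma gdistance_witness:
  assumes "gconnected G" "u \<in> gverts G" "v \<in> gverts G"
  obtains p where "gwalk_betw G u p v" "length p = Suc (gdistance G u v)"
proof -
  obtain q where q: "gwalk_betw G u q v" using assms unfolding gconnected_def by blast
  then have "q \<noteq> []" by (auto simp: gwalk_betw_def gwalk_def)
  then have "length q = Suc (length q - 1)" by simp
  then have "\<exists>k p. gwalk_betw G u p v \<and> length p = Suc k" using q by blast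
  then have "\<exists>p. gwalk_betw G u p v \<and> length p = Suc (gdistance G u v)"
    unfolding gdistance_def by (rule LeastI_ex)
  then show thesis using that by blast
qed

lemma gdistance_le:
  assumes "gwalk_betw G u p v" "length p = Suc k"
  shows "gdistance G u v \<le> k"
  unfolding gdistance_def using assms by (intro Least_le) blast

lemma gdistance_edge:
  assumes "gconnected G" "simple_ugraph G" "r \<in> gverts G" "{a, b} \<in> gedges G"
  shows "gdistance G r b \<le> Suc (gdistance G r a)"
proof -
  have ab: "a \<in> gverts G" "b \<in> gverts G" using simple_ugraph_edgeD assms by metis+
  obtain p where p: "gwalk_betw G r p a" "length p = Suc (gdistance G r a)"
    using gdistance_witness assms(1,3) ab by metis
  have "gwalk_betw G r (p @ [b]) b"
    using p ab assms(4) by (auto simp: gwalk_betw_def gwalk_def successively_append_iff)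
  then show ?thesis using p by (intro gdistance_le) auto
qed

text \<open>\<phi> is the distance from one end of a shortest path that realises the diameter. Later
  arguments need only that \<phi> numbers the path and changes by at most 1 along an edge: this
  makes the path induced and bounds how far apart two path neighbours of one vertex can be.\<close>

lemma diametral_path:
  assumes con: "gconnected G" and G: "simple_ugraph G" and d: "gdiameter G = d"
  obtains u \<phi> where "\<And>k. k \<le> d \<Longrightarrow> u k \<in> gverts G" "\<And>k. k \<le> d \<Longrightarrow> \<phi> (u k) = (k :: nat)"
    "\<And>k. k < d \<Longrightarrow> {u k, u (Suc k)} \<in> gedges G"
    "\<And>a b. {a, b} \<in> gedges G \<Longrightarrow> \<phi> b \<le> Suc (\<phi> a)"
proof -
  let ?D = "{gdistance G u v | u v. u \<in> gverts G \<and> v \<in> gverts G}"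
  have "?D = (\<lambda>(u, v). gdistance G u v) ` (gverts G \<times> gverts G)" by auto
  then have "finite ?D" using finite_gverts[OF G] by simp
  moreover obtain v where "v \<in> gverts G" using con by (auto simp: gconnected_def)
  then have "?D \<noteq> {}" by blast
  ultimately have "Max ?D \<in> ?D" by (rule Max_in)
  then obtain r s where rs: "r \<in> gverts G" "s \<in> gverts G" "gdistance G r s = d"
    using d unfolding gdiameter_def by auto
  obtain p where p: "gwalk_betw G r p s" "length p = Suc d"
    using gdistance_witness con rs by metis
  have sub: "set p \<subseteq> gverts G" and hd: "hd p = r" "last p = s" and ne: "p \<noteq> []"
    and succ: "\<And>k. k < d \<Longrightarrow> {p ! k, p ! Suc k} \<in> gedges G"
    using p by (auto simp: gwalk_betw_def gwalk_def successively_conv_nth)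
  define \<phi> where "\<phi> = gdistance G r"
  have lip: "\<phi> b \<le> Suc (\<phi> a)" if "{a, b} \<in> gedges G" for a b
    unfolding \<phi>_def using gdistance_edge con G rs(1) that by metis
  have "\<phi> (p ! 0) = 0"
  proof -
    have "gwalk_betw G r [r] r" using rs by (simp add: gwalk_betw_def gwalk_def)
    then have "gdistance G r r \<le> 0" by (intro gdistance_le) auto
    then show ?thesis using hd ne by (simp add: \<phi>_def hd_conv_nth)
  qed
  then have up: "\<phi> (p ! k) \<le> k" if "k \<le> d" for k
    using that
  proof (induction k)
    case (Suc k)
    then show ?case using lip[OF succ[of k]] by force
  qed simp
  have top: "\<phi> (p ! d) = d" using rs(3) hd ne p(2) by (simp add: \<phi>_def last_conv_nth)
  \<comment> \<open>Descending from the far end, where \<phi> equals \<open>d\<close>, each edge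
    lowers \<phi> by at most 1.\<close>
  have down: "k \<le> \<phi> (p ! k)" if "k \<le> d" for k
    using that
  proof (induction k rule: inc_induct)
    case base
    then show ?case using top by simp
  next
    case (step k)
    then show ?case using lip[OF succ[of k]] by force
  qed
  show thesis
  proof (rule that[of "(!) p" \<phi>])
    show "p ! k \<in> gverts G" if "k \<le> d" for k using that sub p(2) by force
  qed (use up down succ lip in \<open>auto intro: antisym\<close>)
qed

lemma gdegree_pos_if_gconnected:
  assumes "gconnected G" "simple_ugraph G" "2 \<le> card (gverts G)" "v \<in> gverts G"
  shows "1 \<le> gdegree G v"
proof -
  have "\<not> gverts G \<subseteq> {v}" using assms(3) card_mono[of "{v}" "gverts G"] by auto
  then obtain x where x: "x \<in> gverts G" "x \<noteq> v" by blast
  then obtain p where p: "gwalk_betw G v p x" using assms unfolding gconnected_def by blast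
  then obtain t where "p = v # t" by (cases p) (auto simp: gwalk_betw_def gwalk_def)
  moreover have "t \<noteq> []" using calculation p x by (auto simp: gwalk_betw_def)
  ultimately obtain y q where "p = v # y # q" by (cases t) auto
  then have "{v, y} \<in> gedges G" using p by (simp add: gwalk_betw_def gwalk_def)
  then show ?thesis using card_le_gdegree[OF assms(2), of "{y}" v] by (simp add: nbrs_def)
qed

section \<open>Isomorphisms\<close>

lemma gedges_image_if_giso:
  assumes G: "simple_ugraph G" and H: "simple_ugraph H"
    and f: "bij_betw f (gverts G) (gverts H)"
    and edge: "\<And>u v. u \<in> gverts G \<Longrightarrow> v \<in> gverts G \<Longrightarrow>
      {u, v} \<in> gedges G \<longleftrightarrow> {f u, f v} \<in> gedges H"
  shows "gedges H = (`) f ` gedges G"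
proof (intro equalityI subsetI)
  fix e assume e: "e \<in> gedges H"
  obtain a b where ab: "a \<in> gverts H" "b \<in> gverts H" "e = {a, b}"
    using simple_ugraph_edgeE[OF H e] by metis
  then obtain u v where uv: "u \<in> gverts G" "v \<in> gverts G" "a = f u" "b = f v"
    using f unfolding bij_betw_def by (metis imageE)
  then have "{u, v} \<in> gedges G" "e = f ` {u, v}" using edge ab e by auto
  then show "e \<in> (`) f ` gedges G" by blast
next
  fix e assume "e \<in> (`) f ` gedges G"
  then obtain c where c: "c \<in> gedges G" "e = f ` c" by blast
  obtain u v where "u \<in> gverts G" "v \<in> gverts G" "c = {u, v}"
    using simple_ugraph_edgeE[OF G c(1)] by metis
  then show "e \<in> gedges H" using edge c by auto
qed

text \<open>Supplies the direction of the equality statement from isomorphism to equal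
  index.\<close>

lemma reduced_sombor_giso:
  assumes G: "simple_ugraph G" and H: "simple_ugraph H" and iso: "giso G H"
  shows "reduced_sombor G = reduced_sombor H"
proof -
  obtain f where f: "bij_betw f (gverts G) (gverts H)"
    and edge: "\<And>u v. u \<in> gverts G \<Longrightarrow> v \<in> gverts G \<Longrightarrow>
      {u, v} \<in> gedges G \<longleftrightarrow> {f u, f v} \<in> gedges H"
    using iso unfolding giso_def by blast
  have E: "gedges H = (`) f ` gedges G" by (rule gedges_image_if_giso[OF G H f edge])
  have sub: "e \<subseteq> gverts G" if "e \<in> gedges G" for e
    using simple_ugraph_edgeE[OF G that] by blast
  have inj: "inj_on f (gverts G)" using f by (simp add: bij_betw_def)
  have injE: "inj_on ((`) f) (gedges G)"
    using inj_on_image_Pow[OF inj] by (rule inj_on_subset) (use sub in blast)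
  have deg: "gdegree H (f v) = gdegree G v" if v: "v \<in> gverts G" for v
  proof -
    have "{e \<in> gedges H. f v \<in> e} = (`) f ` {e \<in> gedges G. v \<in> e}"
      unfolding E using inj_on_image_mem_iff[OF inj v sub] by auto
    then show ?thesis unfolding gdegree_def
      using injE by (simp add: card_image inj_on_subset)
  qed
  have "reduced_sombor H = (\<Sum>e\<in>gedges G. sqrt (\<Sum>v\<in>f ` e. (real (gdegree H v) - 1)\<^sup>2))"
    unfolding reduced_sombor_def E by (simp add: sum.reindex[OF injE])
  also have "\<dots> = reduced_sombor G"
    unfolding reduced_sombor_def
  proof (intro sum.cong refl arg_cong[where f = sqrt])
    fix e assume "e \<in> gedges G"
    note e = sub[OF this]
    show "(\<Sum>v\<in>f ` e. (real (gdegree H v) - 1)\<^sup>2) = (\<Sum>v\<in>e. (real (gdegree G v) - 1)\<^sup>2)"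
      using e deg by (simp add: sum.reindex[OF inj_on_subset[OF inj e]] subset_iff)
  qed
  finally show ?thesis by simp
qed

text \<open>The image of the edges of \<open>H\<close> is as large as the edge set of
  \<open>G\<close> that contains it, hence equal to it. So edges have to be checked in one direction
  only.\<close>

lemma gisoI_edges_subset:
  assumes G: "simple_ugraph G" and H: "simple_ugraph H"
    and g: "bij_betw g (gverts H) (gverts G)"
    and sub: "\<And>a b. {a, b} \<in> gedges H \<Longrightarrow> {g a, g b} \<in> gedges G"
    and card: "card (gedges G) \<le> card (gedges H)"
  shows "giso G H"
proof -
  have inj: "inj_on g (gverts H)" using g by (simp add: bij_betw_def)
  have subH: "e \<subseteq> gverts H" if "e \<in> gedges H" for e
    using simple_ugraph_edgeE[OF H that] by blast
  have injE: "inj_on ((`) g) (gedges H)"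
    using inj_on_image_Pow[OF inj] by (rule inj_on_subset) (use subH in blast)
  have "(`) g ` gedges H \<subseteq> gedges G"
  proof
    fix e assume "e \<in> (`) g ` gedges H"
    then obtain c where c: "c \<in> gedges H" "e = g ` c" by blast
    obtain a b where "c = {a, b}" using simple_ugraph_edgeE[OF H c(1)] by metis
    then show "e \<in> gedges G" using sub c by auto
  qed
  then have E: "(`) g ` gedges H = gedges G"
    using card card_image[OF injE] by (intro card_seteq finite_gedges[OF G]) auto
  let ?f = "inv_into (gverts H) g"
  have "bij_betw ?f (gverts G) (gverts H)" using g by (rule bij_betw_inv_into)
  moreover have "{u, v} \<in> gedges G \<longleftrightarrow> {?f u, ?f v} \<in> gedges H"
    if "u \<in> gverts G" "v \<in> gverts G" for u v
  proof -
    have img: "u = g (?f u)" "v = g (?f v)" "?f u \<in> gverts H" "?f v \<in> gverts H"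
      using that g by (auto simp: bij_betw_def f_inv_into_f inv_into_into)
    show ?thesis
    proof
      assume "{u, v} \<in> gedges G"
      then obtain c where c: "c \<in> gedges H" "{u, v} = g ` c" using E by blast
      then have "g ` c = g ` {?f u, ?f v}" using img by auto
      then have "c = {?f u, ?f v}"
        using inj_on_image_eq_iff[OF inj, of c "{?f u, ?f v}"] subH[OF c(1)] img by auto
      then show "{?f u, ?f v} \<in> gedges H" using c by simp
    next
      assume "{?f u, ?f v} \<in> gedges H"
      then show "{u, v} \<in> gedges G" using sub img by metis
    qed
  qed
  ultimately show ?thesis unfolding giso_def by blast
qed

section \<open>The defect of an edge\<close>

definition fd :: "real \<Rightarrow> real \<Rightarrow> real" where
  "fd a b = a + b - sqrt (a\<^sup>2 + b\<^sup>2)"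

lemma fd_commute: "fd a b = fd b a"
  by (simp add: fd_def add.commute)

lemma fd_nonneg: "0 \<le> a \<Longrightarrow> 0 \<le> b \<Longrightarrow> 0 \<le> fd a b"
  unfolding fd_def using sqrt_sum_squares_le_sum[of a b] by simp

text \<open>Since \<open>a < ?s\<close>, the square of \<open>?s + (a' - a)\<close> exceeds
  \<open>a'^2 + b^2\<close> by \<open>2 * (a' - a) * (?s - a)\<close>. So the root grows by less
  than \<open>a' - a\<close>.\<close>

lemma fd_strict_mono:
  assumes "0 \<le> a" "a < a'" "0 < b"
  shows "fd a b < fd a' b"
proof -
  let ?s = "sqrt (a\<^sup>2 + b\<^sup>2)"
  have "a < ?s" using assms by (intro real_less_rsqrt) simp
  then have "2 * (a' - a) * a < 2 * (a' - a) * ?s" using assms by simp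
  moreover have "(?s + (a' - a))\<^sup>2 = a\<^sup>2 + b\<^sup>2 + 2 * (a' - a) * ?s + (a' - a)\<^sup>2"
    by (simp add: power2_sum)
  moreover have "a'\<^sup>2 = a\<^sup>2 + 2 * (a' - a) * a + (a' - a)\<^sup>2"
    by (simp add: power2_eq_square algebra_simps)
  ultimately have "a'\<^sup>2 + b\<^sup>2 < (?s + (a' - a))\<^sup>2" by linarith
  then have "sqrt (a'\<^sup>2 + b\<^sup>2) < ?s + (a' - a)"
    using assms by (intro real_less_lsqrt) auto
  then show ?thesis by (simp add: fd_def)
qed

lemma fd_mono:
  assumes "0 < a" "a \<le> a'" "0 < b" "b \<le> b'"
  shows "fd a b \<le> fd a' b'"
proof -
  have "fd a b \<le> fd a' b" using fd_strict_mono[of a a' b] assms by (cases "a = a'") auto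
  also have "\<dots> \<le> fd a' b'"
    using fd_strict_mono[of b b' a'] assms by (cases "b = b'") (auto simp: fd_commute)
  finally show ?thesis .
qed

lemma sqrt_2_bounds: "1.4142 \<le> sqrt 2" "sqrt 2 \<le> 1.4143"
  by (rule real_le_rsqrt real_le_lsqrt; simp add: power2_eq_square)+

lemma sqrt_5_bounds: "2.236 \<le> sqrt 5" "sqrt 5 \<le> 2.2361"
  by (rule real_le_rsqrt real_le_lsqrt; simp add: power2_eq_square)+

lemma fd_1_1: "fd 1 1 = 2 - sqrt 2"
  by (simp add: fd_def)

lemma fd_2_1: "fd 2 1 = 3 - sqrt 5"
  by (simp add: fd_def)

text \<open>The bound is uniform in \<open>a\<close>, so it applies to the hub whatever its
  degree.\<close>

lemma fd_1_less_1:
  assumes "0 < a"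
  shows "fd a 1 < 1"
proof -
  have "a < sqrt (a\<^sup>2 + 1)" by (intro real_less_rsqrt) simp
  then show ?thesis by (simp add: fd_def)
qed

text \<open>The claim amounts to \<open>?A - ?B < sqrt 5 - sqrt 2\<close>, where the right side is
  about 0.82. As \<open>(?A - ?B) * (?A + ?B) = 3\<close> and \<open>?A + ?B\<close> is at least 5,
  the left side is at most 0.6. It shows that placing the vertex of degree 3 next to the hub is
  costly.\<close>

lemma fd_2_gt:
  assumes a: "2 \<le> a"
  shows "fd a 1 + fd 2 1 < fd a 2 + fd 1 1"
proof -
  let ?A = "sqrt (a\<^sup>2 + 4)" and ?B = "sqrt (a\<^sup>2 + 1)"
  have a2: "4 \<le> a\<^sup>2" using power_mono[OF a, of 2] by simp
  have A: "2.8 \<le> ?A" using a2 by (intro real_le_rsqrt) (simp add: power2_eq_square)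
  have B: "2.2 \<le> ?B" using a2 by (intro real_le_rsqrt) (simp add: power2_eq_square)
  have "(?A - ?B) * (?A + ?B) = 3"
    using a2 by (simp add: algebra_simps)
  moreover have "0.6 * 5 < (?A - ?B) * (?A + ?B)" if "0.6 < ?A - ?B"
    using that A B by (intro mult_strict_mono') auto
  ultimately have "?A - ?B \<le> 0.6" by fastforce
  then show ?thesis using sqrt_2_bounds sqrt_5_bounds
    by (simp add: fd_1_1 fd_2_1) (simp add: fd_def)
qed

section \<open>The index as a quadratic expression minus defects\<close>

definition defect :: "'a ugraph \<Rightarrow> 'a set \<Rightarrow> real" where
  "defect G e = (\<Sum>v\<in>e. real (gdegree G v) - 1) - sqrt (\<Sum>v\<in>e. (real (gdegree G v) - 1)\<^sup>2)"

lemma defect_edge: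
  "a \<noteq> b \<Longrightarrow> defect G {a, b} = fd (real (gdegree G a) - 1) (real (gdegree G b) - 1)"
  by (simp add: defect_def fd_def)

definition inner :: "'a ugraph \<Rightarrow> 'a set" where
  "inner G = {v \<in> gverts G. 2 \<le> gdegree G v}"

context
  fixes G :: "'a ugraph"
  assumes G: "simple_ugraph G"
    and deg1: "\<And>v. v \<in> gverts G \<Longrightarrow> 1 \<le> gdegree G v"
begin

lemma gdegree_leaf: "v \<in> gverts G - inner G \<Longrightarrow> gdegree G v = 1"
  using deg1[of v] by (auto simp: inner_def)

lemma finite_inner: "finite (inner G)"
  using finite_gverts[OF G] by (simp add: inner_def)

lemma sum_inner_leaf:
  fixes h :: "'a \<Rightarrow> real"
  shows "(\<Sum>v\<in>gverts G. h v) = (\<Sum>v\<in>inner G. h v) + (\<Sum>v\<in>gverts G - inner G. h v)"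
  using sum.subset_diff[of "inner G" "gverts G" h] finite_gverts[OF G] by (auto simp: inner_def)

lemma card_leaves: "real (card (gverts G - inner G)) = real (card (gverts G)) - real (card (inner G))"
  using sum_inner_leaf[of "\<lambda>_. 1"] by simp

text \<open>Handshake lemma with the degree split as 1 on leaves and as excess plus 2
  elsewhere.\<close>

lemma sum_inner_excess:
  "(\<Sum>v\<in>inner G. real (gdegree G v - 2)) =
     2 * real (card (gedges G)) - real (card (gverts G)) - real (card (inner G))"
proof -
  have "(\<Sum>e\<in>gedges G. \<Sum>v\<in>e. 1) = (\<Sum>e\<in>gedges G. 2 :: real)"
  proof (intro sum.cong refl)
    fix e assume e: "e \<in> gedges G"
    show "(\<Sum>v\<in>e. 1) = (2 :: real)" using simple_ugraph_edgeE[OF G e] by fastforce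
  qed
  then have "2 * real (card (gedges G)) = (\<Sum>v\<in>gverts G. real (gdegree G v))"
    using sum_edges_eq_sum_degrees[OF G, of "\<lambda>_. 1"] by simp
  also have "\<dots> = (\<Sum>v\<in>inner G. real (gdegree G v)) + real (card (gverts G - inner G))"
    using sum_inner_leaf[of "\<lambda>v. real (gdegree G v)"] gdegree_leaf by simp
  also have "(\<Sum>v\<in>inner G. real (gdegree G v)) = (\<Sum>v\<in>inner G. real (gdegree G v - 2) + 2)"
    by (intro sum.cong) (auto simp: inner_def)
  finally show ?thesis using card_leaves by (simp add: sum.distrib)
qed

lemma reduced_sombor_eq:
  "reduced_sombor G = real (\<Sum>v\<in>inner G. (gdegree G v - 2)\<^sup>2)
     + 3 * (2 * real (card (gedges G)) - real (card (gverts G)) - real (card (inner G)))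
     + 2 * real (card (inner G)) - (\<Sum>e\<in>gedges G. defect G e)"
proof -
  let ?x = "\<lambda>v. real (gdegree G v) - 1"
  have "reduced_sombor G + (\<Sum>e\<in>gedges G. defect G e) = (\<Sum>e\<in>gedges G. \<Sum>v\<in>e. ?x v)"
    unfolding reduced_sombor_def defect_def by (simp add: sum.distrib[symmetric])
  also have "\<dots> = (\<Sum>v\<in>gverts G. real (gdegree G v) * ?x v)"
    by (rule sum_edges_eq_sum_degrees[OF G])
  also have "\<dots> = (\<Sum>v\<in>inner G. real (gdegree G v) * ?x v)"
    using sum_inner_leaf[of "\<lambda>v. real (gdegree G v) * ?x v"] gdegree_leaf by simp
  \<comment> \<open>With excess \<open>y\<close> the summand is
    \<open>(y + 2) * (y + 1) = y^2 + 3 * y + 2\<close>.\<close>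
  also have "\<dots> = (\<Sum>v\<in>inner G. real ((gdegree G v - 2)\<^sup>2) + 3 * real (gdegree G v - 2) + 2)"
  proof (intro sum.cong refl)
    fix v assume "v \<in> inner G"
    then obtain y where y: "gdegree G v = y + 2"
      unfolding inner_def by (metis (lifting) mem_Collect_eq le_add_diff_inverse2)
    show "real (gdegree G v) * ?x v = real ((gdegree G v - 2)\<^sup>2) + 3 * real (gdegree G v - 2) + 2"
      unfolding y by (simp add: power2_eq_square algebra_simps)
  qed
  also have "\<dots> = real (\<Sum>v\<in>inner G. (gdegree G v - 2)\<^sup>2)
      + 3 * (\<Sum>v\<in>inner G. real (gdegree G v - 2)) + 2 * real (card (inner G))"
    by (simp add: sum.distrib sum_distrib_left)
  finally show ?thesis using sum_inner_excess by simp
qed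

text \<open>An edge that is not inside \<open>inner G\<close> has a leaf as an end, and each leaf
  lies on exactly one edge.\<close>

lemma card_inner_edges:
  "real (card (gedges G)) + real (card (inner G)) - real (card (gverts G))
     \<le> real (card {e \<in> gedges G. e \<subseteq> inner G})"
proof -
  let ?I = "{e \<in> gedges G. e \<subseteq> inner G}" and ?L = "gverts G - inner G"
  have "gedges G - ?I \<subseteq> (\<Union>v\<in>?L. {e \<in> gedges G. v \<in> e})"
  proof
    fix e assume e: "e \<in> gedges G - ?I"
    then obtain a b where "a \<in> gverts G" "b \<in> gverts G" "e = {a, b}"
      using simple_ugraph_edgeE[OF G, of e] by blast
    then show "e \<in> (\<Union>v\<in>?L. {e \<in> gedges G. v \<in> e})" using e by auto
  qed
  then have "card (gedges G - ?I) \<le> card (\<Union>v\<in>?L. {e \<in> gedges G. v \<in> e})"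
    using finite_gverts[OF G] finite_gedges[OF G] by (intro card_mono) auto
  also have "\<dots> \<le> (\<Sum>v\<in>?L. gdegree G v)"
    unfolding gdegree_def using finite_gverts[OF G] by (intro card_UN_le) simp
  also have "\<dots> = card ?L" using gdegree_leaf by simp
  finally have "real (card (gedges G - ?I)) \<le> real (card ?L)" by simp
  moreover have "card (gedges G - ?I) + card ?I = card (gedges G)"
    using card_Diff_subset[of ?I "gedges G"] card_mono[of "gedges G" ?I] finite_gedges[OF G] by auto
  ultimately show ?thesis using card_leaves by linarith
qed

lemma defect_nonneg:
  assumes "e \<in> gedges G"
  shows "0 \<le> defect G e"
proof -
  obtain a b where "a \<in> gverts G" "b \<in> gverts G" "a \<noteq> b" "e = {a, b}"
    using simple_ugraph_edgeE[OF G assms] by metis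
  then show ?thesis using deg1[of a] deg1[of b] by (simp add: defect_edge fd_nonneg)
qed

lemma defect_inner:
  assumes "e \<in> gedges G" "e \<subseteq> inner G"
  shows "fd 1 1 \<le> defect G e"
proof -
  obtain a b where "a \<noteq> b" "e = {a, b}"
    using simple_ugraph_edgeE[OF G assms(1)] by metis
  moreover from this have "a \<in> inner G" "b \<in> inner G" using assms(2) by auto
  ultimately show ?thesis by (simp add: defect_edge inner_def fd_mono)
qed

text \<open>Every edge between non-leaves is charged \<open>fd 1 1\<close>. \<open>K\<close> selects
  the edges whose surplus over this charge is kept as well; all other surpluses are dropped.\<close>

lemma sum_defect_ge:
  assumes K: "K \<subseteq> {e \<in> gedges G. e \<subseteq> inner G}"
  shows "fd 1 1 * (real (card (gedges G)) + real (card (inner G)) - real (card (gverts G)))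
     + (\<Sum>e\<in>K. defect G e - fd 1 1) \<le> (\<Sum>e\<in>gedges G. defect G e)"
proof -
  let ?I = "{e \<in> gedges G. e \<subseteq> inner G}"
  have "fd 1 1 * (real (card (gedges G)) + real (card (inner G)) - real (card (gverts G)))
      \<le> fd 1 1 * real (card ?I)"
    using card_inner_edges by (intro mult_left_mono fd_nonneg) auto
  moreover have "(\<Sum>e\<in>K. defect G e - fd 1 1) \<le> (\<Sum>e\<in>?I. defect G e - fd 1 1)"
    using K finite_gedges[OF G] defect_inner by (intro sum_mono2) auto
  moreover have "(\<Sum>e\<in>?I. defect G e) \<le> (\<Sum>e\<in>gedges G. defect G e)"
    using finite_gedges[OF G] defect_nonneg by (intro sum_mono2) auto
  ultimately show ?thesis by (simp add: sum_subtractf mult.commute)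
qed

end

section \<open>Sums of squares of the excesses\<close>

lemma sum_squares_le_square_sum:
  fixes y :: "'a \<Rightarrow> nat"
  assumes "finite A"
  shows "(\<Sum>v\<in>A. (y v)\<^sup>2) \<le> (\<Sum>v\<in>A. y v)\<^sup>2"
  using assms
proof (induction A)
  case (insert x A)
  then show ?case by (simp add: power2_sum)
qed simp

text \<open>Subtract 1 from \<open>y a\<close> and \<open>y b\<close>, collect the rest in
  \<open>r\<close> and the slack below \<open>N\<close> in \<open>s\<close>. The distance to
  \<open>(N - 1)^2 + 1\<close> is then at least an explicit polynomial in natural numbers, which is
  at least 2 unless \<open>r = s = 0\<close> and \<open>p = 0\<close> or \<open>q = 0\<close>. This
  gap of 2 is what later outweighs the defects of the extremal graph.\<close>

lemma sum_squares_two_positive: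
  fixes y :: "'a \<Rightarrow> nat"
  assumes fin: "finite A" and ab: "a \<in> A" "b \<in> A" "a \<noteq> b" and pos: "1 \<le> y a" "1 \<le> y b"
    and sum: "(\<Sum>v\<in>A. y v) \<le> N"
  shows "(\<Sum>v\<in>A. (y v)\<^sup>2) + 2 \<le> (N - 1)\<^sup>2 + 1 \<or>
    (\<Sum>v\<in>A. y v) = N \<and> (y a = N - 1 \<and> y b = 1 \<or> y a = 1 \<and> y b = N - 1) \<and>
    (\<forall>v\<in>A - {a, b}. y v = 0)"
proof -
  let ?B = "A - {a, b}"
  define r where "r = (\<Sum>v\<in>?B. y v)"
  obtain p q where pq: "y a = p + 1" "y b = q + 1" using pos by (metis add.commute le_Suc_ex)
  have split: "(\<Sum>v\<in>A. h v) = h a + h b + (\<Sum>v\<in>?B. h v)" for h :: "'a \<Rightarrow> nat"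
  proof -
    have "(\<Sum>v\<in>A. h v) = (\<Sum>v\<in>?B. h v) + (\<Sum>v\<in>{a, b}. h v)"
      using fin ab by (intro sum.subset_diff) auto
    then show ?thesis using ab by simp
  qed
  have r2: "(\<Sum>v\<in>?B. (y v)\<^sup>2) \<le> r\<^sup>2"
    unfolding r_def using fin by (intro sum_squares_le_square_sum) simp
  obtain s where s: "N = p + q + r + 2 + s"
    using sum pq by (auto simp: split r_def le_iff_add)
  have "(\<Sum>v\<in>A. (y v)\<^sup>2) \<le> (p + 1)\<^sup>2 + (q + 1)\<^sup>2 + r\<^sup>2"
    using r2 pq by (simp add: split)
  moreover have "(N - 1)\<^sup>2 + 1 = (p + 1)\<^sup>2 + (q + 1)\<^sup>2 + r\<^sup>2
      + (2 * p * q + 2 * p * r + 2 * q * r + 2 * r + s * (2 * (p + q + r + 1) + s))"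
    unfolding s by (simp add: power2_eq_square algebra_simps)
  moreover have "2 \<le> 2 * p * q + 2 * p * r + 2 * q * r + 2 * r + s * (2 * (p + q + r + 1) + s)"
    if nz: "\<not> (r = 0 \<and> s = 0 \<and> (p = 0 \<or> q = 0))"
  proof -
    consider "r \<ge> 1" | "s \<ge> 1" | "1 \<le> p * q" using nz by (cases r; cases s; cases p; cases q) auto
    then show ?thesis
    proof cases
      case 2
      then have "1 * 2 \<le> s * (2 * (p + q + r + 1) + s)" by (intro mult_le_mono) auto
      then show ?thesis by linarith
    next
      case 3
      then show ?thesis by (simp only: mult.assoc)
    qed auto
  qed
  ultimately consider "(\<Sum>v\<in>A. (y v)\<^sup>2) + 2 \<le> (N - 1)\<^sup>2 + 1" | "r = 0" "s = 0" "p = 0 \<or> q = 0"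
    by linarith
  then show ?thesis
  proof cases
    case 2
    then have "\<forall>v\<in>?B. y v = 0" using fin by (simp add: r_def)
    then show ?thesis using 2 pq s by (auto simp: split)
  qed simp
qed

section \<open>The extremal graph\<close>

lemma gverts_U_graph: "gverts (U_graph n d) = {1..n}"
  by (simp add: U_graph_def)

lemma gedges_U_graph:
  "gedges (U_graph n d) = (\<lambda>i. {i, Suc i}) ` {1..d} \<union>
     ({{d + 2, 2}, {d + 2, 4}} \<union> (\<lambda>j. {2, j}) ` {d + 3..n})"
  by (auto simp: U_graph_def)

lemma simple_U_graph:
  assumes "4 \<le> d" "d + 2 \<le> n"
  shows "simple_ugraph (U_graph n d)"
  unfolding simple_ugraph_def gverts_U_graph
proof (intro conjI ballI)
  fix e assume "e \<in> gedges (U_graph n d)"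
  then consider i where "i \<in> {1..d}" "e = {i, Suc i}" | "e = {d + 2, 2}" | "e = {d + 2, 4}"
    | j where "j \<in> {d + 3..n}" "e = {2, j}"
    unfolding gedges_U_graph by blast
  then show "\<exists>u\<in>{1..n}. \<exists>v\<in>{1..n}. u \<noteq> v \<and> e = {u, v}"
  proof cases
    case 1
    then show ?thesis using assms by (intro bexI[of _ i] bexI[of _ "Suc i"]) auto
  next
    case 2
    then show ?thesis using assms by (intro bexI[of _ "d + 2"] bexI[of _ 2]) auto
  next
    case 3
    then show ?thesis using assms by (intro bexI[of _ "d + 2"] bexI[of _ 4]) auto
  next
    case 4
    then show ?thesis using assms by (intro bexI[of _ 2] bexI[of _ j]) auto
  qed
qed simp

text \<open>The path, the two edges at \<open>d + 2\<close> and the further pendent edges are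
  disjoint families; \<open>4 \<le> d\<close> keeps \<open>{d + 2, 4}\<close> off the path. It
  yields both the number of edges and the index.\<close>

lemma sum_gedges_U_graph:
  fixes h :: "nat set \<Rightarrow> real"
  assumes "4 \<le> d"
  shows "(\<Sum>e\<in>gedges (U_graph n d). h e) = (\<Sum>i\<in>{1..d}. h {i, Suc i})
    + h {d + 2, 2} + h {d + 2, 4} + (\<Sum>j\<in>{d + 3..n}. h {2, j})"
proof -
  define A B C where "A = (\<lambda>i. {i, Suc i}) ` {1..d}" and "B = {{d + 2, 2}, {d + 2, 4}}"
    and "C = (\<lambda>j. {2, j}) ` {d + 3..n}"
  have "inj_on (\<lambda>i. {i, Suc i}) {1..d}" by (auto simp: inj_on_def doubleton_eq_iff)
  then have A: "sum h A = (\<Sum>i\<in>{1..d}. h {i, Suc i})" by (simp add: A_def sum.reindex)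
  have "inj_on (\<lambda>j. {2, j}) {d + 3..n}" by (auto simp: inj_on_def doubleton_eq_iff)
  then have C: "sum h C = (\<Sum>j\<in>{d + 3..n}. h {2, j})" by (simp add: C_def sum.reindex)
  have B: "sum h B = h {d + 2, 2} + h {d + 2, 4}"
    unfolding B_def by (subst sum.insert) (simp_all add: doubleton_eq_iff)
  have "{i, Suc i} \<notin> B" "{i, Suc i} \<notin> C" if "i \<in> {1..d}" for i
    using that assms by (auto simp: B_def C_def doubleton_eq_iff)
  then have "A \<inter> (B \<union> C) = {}" by (auto simp: A_def)
  moreover have "B \<inter> C = {}" using assms by (auto simp: B_def C_def doubleton_eq_iff)
  moreover have "finite A" "finite B" "finite C" by (simp_all add: A_def B_def C_def)
  ultimately have "sum h (A \<union> (B \<union> C)) = sum h A + (sum h B + sum h C)"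
    by (simp add: sum.union_disjoint)
  moreover have "gedges (U_graph n d) = A \<union> (B \<union> C)"
    unfolding gedges_U_graph A_def B_def C_def ..
  ultimately show ?thesis using A B C by simp
qed

lemma card_gedges_U_graph:
  assumes "4 \<le> d" "d + 2 \<le> n"
  shows "card (gedges (U_graph n d)) = n"
proof -
  have "real (card (gedges (U_graph n d))) = real n"
    using sum_gedges_U_graph[OF assms(1), where n = n and h = "\<lambda>_. 1"] assms by simp
  then show ?thesis by simp
qed

text \<open>Turns adjacency into linear arithmetic, so that the neighbourhoods behind the degrees
  can be decided mechanically.\<close>

lemma mem_nbrs_U_graph:
  "x \<in> nbrs (U_graph n d) v \<longleftrightarrow>
     1 \<le> v \<and> v \<le> d \<and> x = v + 1 \<or> 1 \<le> x \<and> x \<le> d \<and> v = x + 1 \<or>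
     v = d + 2 \<and> x = 2 \<or> v = 2 \<and> x = d + 2 \<or> v = d + 2 \<and> x = 4 \<or> v = 4 \<and> x = d + 2 \<or>
     v = 2 \<and> d + 3 \<le> x \<and> x \<le> n \<or> x = 2 \<and> d + 3 \<le> v \<and> v \<le> n"
proof -
  have "{v, x} \<in> (\<lambda>i. {i, Suc i}) ` {1..d} \<longleftrightarrow>
      1 \<le> v \<and> v \<le> d \<and> x = v + 1 \<or> 1 \<le> x \<and> x \<le> d \<and> v = x + 1"
    by (auto simp: doubleton_eq_iff image_iff)
  moreover have "{v, x} \<in> (\<lambda>j. {2, j}) ` {d + 3..n} \<longleftrightarrow>
      v = 2 \<and> d + 3 \<le> x \<and> x \<le> n \<or> x = 2 \<and> d + 3 \<le> v \<and> v \<le> n"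
    by (auto simp: doubleton_eq_iff image_iff)
  moreover have "{v, x} \<in> {{d + 2, 2}, {d + 2, 4}} \<longleftrightarrow>
      v = d + 2 \<and> x = 2 \<or> v = 2 \<and> x = d + 2 \<or> v = d + 2 \<and> x = 4 \<or> v = 4 \<and> x = d + 2"
    by (auto simp: doubleton_eq_iff)
  ultimately show ?thesis unfolding nbrs_def gedges_U_graph mem_Collect_eq Un_iff by argo
qed

lemma gdegree_U_graph:
  assumes "4 \<le> d" "d + 2 \<le> n"
  shows "gdegree (U_graph n d) 1 = 1" "gdegree (U_graph n d) 2 = n - d + 1"
    "gdegree (U_graph n d) 3 = 2" "gdegree (U_graph n d) 4 = 3"
    "5 \<le> i \<Longrightarrow> i \<le> d \<Longrightarrow> gdegree (U_graph n d) i = 2"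
    "gdegree (U_graph n d) (d + 1) = 1" "gdegree (U_graph n d) (d + 2) = 2"
    "d + 3 \<le> j \<Longrightarrow> j \<le> n \<Longrightarrow> gdegree (U_graph n d) j = 1"
proof -
  note D = gdegree_eq_card_nbrs[OF simple_U_graph[OF assms]]
  have "nbrs (U_graph n d) 1 = {2}"
    using assms by (intro set_eqI) (simp add: mem_nbrs_U_graph, presburger)
  then show "gdegree (U_graph n d) 1 = 1" by (simp add: D)
  have "nbrs (U_graph n d) 2 = {1, 3} \<union> {d + 2..n}"
    using assms by (intro set_eqI) (simp add: mem_nbrs_U_graph, presburger)
  then show "gdegree (U_graph n d) 2 = n - d + 1"
    using assms card_Un_disjoint[of "{1, 3}" "{d + 2..n}"] by (simp add: D)
  have "nbrs (U_graph n d) 3 = {2, 4}"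
    using assms by (intro set_eqI) (simp add: mem_nbrs_U_graph, presburger)
  then show "gdegree (U_graph n d) 3 = 2" by (simp add: D)
  have "nbrs (U_graph n d) 4 = {3, 5, d + 2}"
    using assms by (intro set_eqI) (simp add: mem_nbrs_U_graph, presburger)
  then show "gdegree (U_graph n d) 4 = 3" using assms by (simp add: D)
  have "nbrs (U_graph n d) (d + 1) = {d}"
    using assms by (intro set_eqI) (simp add: mem_nbrs_U_graph, presburger)
  then show "gdegree (U_graph n d) (d + 1) = 1" by (simp add: D)
  have "nbrs (U_graph n d) (d + 2) = {2, 4}"
    using assms by (intro set_eqI) (simp add: mem_nbrs_U_graph, presburger)
  then show "gdegree (U_graph n d) (d + 2) = 2" by (simp add: D)
  show "gdegree (U_graph n d) i = 2" if "5 \<le> i" "i \<le> d"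
  proof -
    have "nbrs (U_graph n d) i = {i - 1, Suc i}"
      using assms that by (intro set_eqI) (simp add: mem_nbrs_U_graph, presburger)
    then show ?thesis by (simp add: D)
  qed
  show "gdegree (U_graph n d) j = 1" if "d + 3 \<le> j" "j \<le> n"
  proof -
    have "nbrs (U_graph n d) j = {2}"
      using assms that by (intro set_eqI) (simp add: mem_nbrs_U_graph, presburger)
    then show ?thesis by (simp add: D)
  qed
qed

text \<open>The value is arranged for comparison with \<open>sum_defect_ge\<close>: \<open>d\<close>
  edges between non-leaves are charged \<open>fd 1 1\<close>. A surplus comes from the two such
  edges at the hub \<open>2\<close> and from those at \<open>4\<close>, which are two if
  \<open>d = 4\<close>, where \<open>5\<close> is a leaf, and three otherwise.\<close>

lemma reduced_sombor_U_graph: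
  assumes "4 \<le> d" "d + 2 \<le> n"
  shows "reduced_sombor (U_graph n d) =
    (real (n - d) - 1)\<^sup>2 + 1 + 3 * real (n - d) + 2 * real d - real d * fd 1 1
    - 2 * (fd (real (n - d)) 1 - fd 1 1) - (if d = 4 then 2 else 3) * (fd 2 1 - fd 1 1)"
proof -
  define N where "N = real (n - d)"
  define x where "x v = real (gdegree (U_graph n d) v) - 1" for v
  define h where "h e = sqrt (\<Sum>v\<in>e. (x v)\<^sup>2)" for e
  have h: "h {a, b} = sqrt ((x a)\<^sup>2 + (x b)\<^sup>2)" if "a \<noteq> b" for a b
    using that by (simp add: h_def)
  note deg = gdegree_U_graph[OF assms]
  have x: "x 1 = 0" "x 2 = N" "x 3 = 1" "x 4 = 2" "x (d + 1) = 0" "x (d + 2) = 1"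
    unfolding x_def deg by (simp_all add: N_def)
  have x5: "x i = 1" if "5 \<le> i" "i \<le> d" for i
    unfolding x_def deg(5)[OF that] by simp
  have pend: "(\<Sum>j\<in>{d + 3..n}. h {2, j}) = (N - 2) * N"
  proof -
    have "h {2, j} = N" if "j \<in> {d + 3..n}" for j
    proof -
      have "x j = 0" using that deg(8)[of j] by (simp add: x_def)
      then show ?thesis using that assms by (subst h) (auto simp: x N_def)
    qed
    then have "(\<Sum>j\<in>{d + 3..n}. h {2, j}) = real (card {d + 3..n}) * N" by simp
    moreover have "real (card {d + 3..n}) = N - 2" using assms by (simp add: N_def)
    ultimately show ?thesis by simp
  qed
  have w: "h {d + 2, 2} = sqrt (N\<^sup>2 + 1)" "h {d + 2, 4} = sqrt 5"
    using assms by (subst h; force simp: x(2,4,6) add.commute simp del: add_2_eq_Suc')+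
  have path: "(\<Sum>i\<in>{1..d}. h {i, Suc i}) =
      h {1, 2} + h {2, 3} + h {3, 4} + (\<Sum>i\<in>{4..d}. h {i, Suc i})"
  proof -
    have "{1..d} = insert 1 (insert 2 (insert 3 {4..d}))" using assms by auto
    then show ?thesis by (simp add: eval_nat_numeral)
  qed
  have p3: "h {1, 2} = N" "h {2, 3} = sqrt (N\<^sup>2 + 1)" "h {3, 4} = sqrt 5"
    by (simp_all only: h x) (simp_all add: h x N_def)
  \<comment> \<open>For \<open>d = 4\<close> the only edge left joins \<open>4\<close> to the leaf
    at the end of the path and contributes 2.\<close>
  have tail: "(\<Sum>i\<in>{4..d}. h {i, Suc i}) =
      (if d = 4 then 2 else sqrt 5 + sqrt 2 * (real d - 5) + 1)"
  proof (cases "d = 4")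
    case True
    then show ?thesis using x(5) by (simp add: h x(4))
  next
    case False
    then have "{4..d} = insert 4 (insert d {5..<d})" using assms by auto
    then have "(\<Sum>i\<in>{4..d}. h {i, Suc i}) =
        h {4, 5} + (h {d, Suc d} + (\<Sum>i\<in>{5..<d}. h {i, Suc i}))"
      using False by simp
    moreover have "(\<Sum>i\<in>{5..<d}. h {i, Suc i}) = (\<Sum>i\<in>{5..<d}. sqrt 2)"
      by (intro sum.cong refl) (simp add: h x5)
    moreover have "h {4, 5} = sqrt 5" "h {d, Suc d} = 1"
      using False assms x(5) by (simp_all add: h x(4) x5)
    ultimately show ?thesis using False assms by simp
  qed
  have "reduced_sombor (U_graph n d) = (\<Sum>e\<in>gedges (U_graph n d). h e)"
    by (simp add: reduced_sombor_def h_def x_def)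
  also have "\<dots> = N + 2 * sqrt (N\<^sup>2 + 1) + 2 * sqrt 5 + (N - 2) * N
      + (if d = 4 then 2 else sqrt 5 + sqrt 2 * (real d - 5) + 1)"
    unfolding sum_gedges_U_graph[OF assms(1)] pend w path p3 tail by simp
  finally have eq: "reduced_sombor (U_graph n d) = \<dots>" .
  have "fd N 1 = N + 1 - sqrt (N\<^sup>2 + 1)" by (simp add: fd_def)
  then show ?thesis
    unfolding N_def[symmetric] fd_1_1 fd_2_1 eq
    by (cases "d = 4") (simp_all add: power2_eq_square left_diff_distrib right_diff_distrib)
qed

section \<open>A hub on a diametral path\<close>

text \<open>These are the values of degree minus 1, not degree minus 2, along the inner path
  vertices; \<open>N\<close> stands for \<open>n - d\<close>.\<close>

definition path_excess :: "real \<Rightarrow> nat \<Rightarrow> nat \<Rightarrow> nat \<Rightarrow> real" where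
  "path_excess N p q k = (if k = p then N else if k = q then 2 else 1)"

text \<open>
  The hub \<open>u p\<close> has the largest degree. The graph $U_n^d$ is the case \<open>p = 1\<close>, \<open>q = 3\<close>; paths are
  numbered from 0 here.
\<close>

locale hub_graph =
  fixes G :: "'a ugraph" and n d :: nat and u :: "nat \<Rightarrow> 'a" and w :: 'a and p q :: nat
  assumes G: "simple_ugraph G"
    and card_V: "card (gverts G) = n" and card_E: "card (gedges G) = n"
    and d4: "4 \<le> d" and dn: "d + 2 \<le> n"
    and deg1: "\<And>v. v \<in> gverts G \<Longrightarrow> 1 \<le> gdegree G v"
    and u_V: "\<And>k. k \<le> d \<Longrightarrow> u k \<in> gverts G" and u_inj: "inj_on u {..d}"
    and u_edge: "\<And>k. k < d \<Longrightarrow> {u k, u (Suc k)} \<in> gedges G"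
    and u_induced: "\<And>a b. a \<le> d \<Longrightarrow> b \<le> d \<Longrightarrow> {u a, u b} \<in> gedges G \<Longrightarrow> b \<le> Suc a"
    and w_V: "w \<in> gverts G" and w_off: "w \<notin> u ` {..d}"
    and inner_eq: "inner G = insert w (u ` {1..<d})"
    and wp: "{w, u p} \<in> gedges G" and wq: "{w, u q} \<in> gedges G"
    and p: "1 \<le> p" "p < d" and q: "1 \<le> q" "q < d"
    and pq: "p \<noteq> q" "q \<le> p + 2" "p \<le> q + 2"
    and deg_p: "gdegree G (u p) = n - d + 1" and deg_q: "gdegree G (u q) = 3"
    and deg_other: "\<And>v. v \<in> inner G - {u p, u q} \<Longrightarrow> gdegree G v = 2"
begin

lemma u_eq_iff: "a \<le> d \<Longrightarrow> b \<le> d \<Longrightarrow> u a = u b \<longleftrightarrow> a = b"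
  using u_inj by (auto simp: inj_on_def)

lemma w_neq: "a \<le> d \<Longrightarrow> w \<noteq> u a"
  using w_off by auto

lemma card_inner: "card (inner G) = d"
proof -
  have "inj_on u {1..<d}" using u_inj by (rule inj_on_subset) auto
  then have "card (u ` {1..<d}) = d - 1" by (simp add: card_image)
  moreover have "w \<notin> u ` {1..<d}" using w_off by auto
  ultimately show ?thesis using d4 by (simp add: inner_eq)
qed

abbreviation exc :: "nat \<Rightarrow> real" where
  "exc \<equiv> path_excess (real (n - d)) p q"

lemma gdegree_w: "gdegree G w = 2"
  using deg_other[of w] w_neq p q by (simp add: inner_eq)

lemma gdegree_u:
  assumes "1 \<le> k" "k < d"
  shows "real (gdegree G (u k)) - 1 = exc k"
proof -
  consider "k = p" | "k = q" | "k \<noteq> p" "k \<noteq> q" by blast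
  then show ?thesis
  proof cases
    case 3
    then have "u k \<in> inner G - {u p, u q}" using assms p q by (auto simp: inner_eq u_eq_iff)
    then show ?thesis using 3 deg_other by (simp add: path_excess_def)
  qed (use pq deg_p deg_q in \<open>auto simp: path_excess_def\<close>)
qed

text \<open>Applies \<open>sum_defect_ge\<close> to the two edges from \<open>w\<close> and to the
  path edges starting at the positions in \<open>J\<close>. The condition on \<open>J\<close> leaves
  out the two end edges of the path, whose outer ends are leaves.\<close>

lemma reduced_sombor_le:
  assumes J: "J \<subseteq> {k. 1 \<le> k \<and> Suc k < d}"
  shows "reduced_sombor G \<le>
    (real (n - d) - 1)\<^sup>2 + 1 + 3 * real (n - d) + 2 * real d - real d * fd 1 1
    - (fd (real (n - d)) 1 - fd 1 1) - (fd 2 1 - fd 1 1)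
    - (\<Sum>k\<in>J. fd (exc k) (exc (Suc k)) - fd 1 1)"
proof -
  let ?P = "(\<lambda>k. {u k, u (Suc k)}) ` J" and ?W = "{{w, u p}, {w, u q}}"
  let ?h = "\<lambda>e. defect G e - fd 1 1"
  have "?W \<union> ?P \<subseteq> {e \<in> gedges G. e \<subseteq> inner G}"
    using J u_edge wp wq p q by (auto simp: inner_eq)
  note D = sum_defect_ge[OF G deg1 this]
  have finJ: "finite J" using J by (rule finite_subset) (rule finite_subset[of _ "{..d}"], auto)
  have injP: "inj_on (\<lambda>k. {u k, u (Suc k)}) J"
  proof (rule inj_onI)
    fix a b assume ab: "a \<in> J" "b \<in> J" "{u a, u (Suc a)} = {u b, u (Suc b)}"
    then have "a \<le> d" "b \<le> d" "Suc a \<le> d" "Suc b \<le> d" using J by auto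
    then show "a = b" using ab(3) by (auto simp: doubleton_eq_iff u_eq_iff)
  qed
  have h: "defect G {u k, u (Suc k)} = fd (exc k) (exc (Suc k))" if "k \<in> J" for k
    using that J u_eq_iff[of k "Suc k"] gdegree_u[of k] gdegree_u[of "Suc k"]
    by (subst defect_edge) auto
  have "(\<Sum>e\<in>?P. ?h e) = (\<Sum>k\<in>J. fd (exc k) (exc (Suc k)) - fd 1 1)"
    using injP by (simp add: sum.reindex h)
  moreover have "(\<Sum>e\<in>?W. ?h e) = (fd (real (n - d)) 1 - fd 1 1) + (fd 2 1 - fd 1 1)"
  proof -
    have "{w, u p} \<noteq> {w, u q}" using u_eq_iff[of p q] p q pq by (auto simp: doubleton_eq_iff)
    moreover have "defect G {w, u p} = fd (real (n - d)) 1" "defect G {w, u q} = fd 2 1"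
     
        using w_neq[of p] w_neq[of q] p q by (simp_all add: defect_edge gdegree_w deg_p deg_q fd_commute)
    ultimately show ?thesis by simp
  qed
  moreover have "?W \<inter> ?P = {}"
  proof -
    have "w \<noteq> u k" "w \<noteq> u (Suc k)" if "k \<in> J" for k
      using that J by (auto intro!: w_neq)
    then show ?thesis by (auto simp: doubleton_eq_iff)
  qed
  then have "(\<Sum>e\<in>?W \<union> ?P. ?h e) = (\<Sum>e\<in>?W. ?h e) + (\<Sum>e\<in>?P. ?h e)"
    using finJ by (intro sum.union_disjoint) auto
  moreover have "real (\<Sum>v\<in>inner G. (gdegree G v - 2)\<^sup>2) = (real (n - d) - 1)\<^sup>2 + 1"
  proof -
    have sub: "{u p, u q} \<subseteq> inner G" using p q by (auto simp: inner_eq)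
    have "(\<Sum>v\<in>inner G. (gdegree G v - 2)\<^sup>2) = (\<Sum>v\<in>{u p, u q}. (gdegree G v - 2)\<^sup>2)"
      using deg_other finite_inner[OF G deg1] sub by (intro sum.mono_neutral_right) auto
    also have "\<dots> = (n - d - 1)\<^sup>2 + 1"
      using u_eq_iff[of p q] p q pq by (simp add: deg_p deg_q)
    finally show ?thesis using dn by simp
  qed
  ultimately show ?thesis
    using D reduced_sombor_eq[OF G deg1] dn
    by (simp add: card_V card_E card_inner mult.commute)
qed

text \<open>The edges at \<open>w\<close> cancel one hub surplus and one surplus
  \<open>fd 2 1 - fd 1 1\<close> of the extremal graph. At most one and two of these remain, and the
  chosen path edges have to beat them.\<close>

lemma reduced_sombor_less:
  assumes J: "J \<subseteq> {k. 1 \<le> k \<and> Suc k < d}"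
    and gain: "(fd (real (n - d)) 1 - fd 1 1) + 2 * (fd 2 1 - fd 1 1)
      < (\<Sum>k\<in>J. fd (exc k) (exc (Suc k)) - fd 1 1)"
  shows "reduced_sombor G < reduced_sombor (U_graph n d)"
proof -
  have "fd 1 1 \<le> fd 2 1" by (rule fd_mono) auto
  then show ?thesis
    using reduced_sombor_le[OF J] gain unfolding reduced_sombor_U_graph[OF d4 dn]
    by (cases "d = 4") simp_all
qed

text \<open>The degree of the hub forces every vertex outside the path and \<open>w\<close> to be
  adjacent to it. So all edges of \<open>U_graph\<close> occur in \<open>G\<close>, and the edge
  counts agree.\<close>

lemma giso_U_graph:
  assumes "p = 1" "q = 3"
  shows "giso G (U_graph n d)"
proof -
  define R where "R = gverts G - u ` {..d} - {w}"
  have path: "u ` {..d} \<subseteq> gverts G" using u_V by auto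
  have finV: "finite (gverts G)" by (rule finite_gverts[OF G])
  have card_R: "card R = n - d - 2"
  proof -
    have "card (u ` {..d}) = d + 1" using u_inj by (simp add: card_image)
    then have "card (gverts G - u ` {..d}) = n - (d + 1)"
      using path by (simp add: card_Diff_subset card_V)
    then show ?thesis using w_V w_off finV by (simp add: R_def)
  qed
  \<comment> \<open>The inclusion holds because the path is induced. Both sides have
    \<open>n - d - 2\<close> elements: the hub has degree \<open>n - d + 1\<close>, and three of its
    neighbours are removed.\<close>
  have R: "nbrs G (u 1) - {u 0, u 2, w} = R"
  proof (rule card_subset_eq)
    show "finite R" using finV by (simp add: R_def)
    show "nbrs G (u 1) - {u 0, u 2, w} \<subseteq> R"
    proof
      fix x assume x: "x \<in> nbrs G (u 1) - {u 0, u 2, w}"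
      have "x \<noteq> u k" if "k \<le> d" for k
      proof
        assume k: "x = u k"
        then have "k \<le> 2" using x u_induced[of 1 k] that d4 by (simp add: nbrs_def)
        moreover have "x \<noteq> u 1" using x nbrs_subset[OF G] by blast
        ultimately show False using x k by (auto simp: le_Suc_eq numeral_2_eq_2)
      qed
      then show "x \<in> R" using x nbrs_subset[OF G, of "u 1"] by (auto simp: R_def)
    qed
    have sub: "{u 0, u 2, w} \<subseteq> nbrs G (u 1)"
      using u_edge[of 0] u_edge[of 1] d4 wp assms
      by (simp add: nbrs_def insert_commute numeral_2_eq_2)
    moreover have "card {u 0, u 2, w} = 3"
      using u_eq_iff[of 0 2] w_neq[of 0] w_neq[of 2] d4 by simp
    moreover have "card (nbrs G (u 1)) = n - d + 1"
      using deg_p assms by (simp add: gdegree_eq_card_nbrs[OF G])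
    ultimately have "card (nbrs G (u 1) - {u 0, u 2, w}) = n - d + 1 - 3"
      by (simp add: card_Diff_subset)
    then show "card (nbrs G (u 1) - {u 0, u 2, w}) = card R" using card_R dn by simp
  qed
  have "card {d + 3..n} = card R" using card_R by simp
  then obtain \<beta> where \<beta>: "bij_betw \<beta> {d + 3..n} R"
    using finite_same_card_bij[of "{d + 3..n}" R] finV by (auto simp: R_def)
  \<comment> \<open>The shift by 1 reconciles the path of \<open>U_graph\<close>, numbered from 1,
    with \<open>u\<close>, numbered from 0. \<beta> matches the remaining pendent vertices in any
    order.\<close>
  define g where "g i = (if i \<le> d + 1 then u (i - 1) else if i = d + 2 then w else \<beta> i)" for i
  have "bij_betw g ({1..d + 1} \<union> {d + 2} \<union> {d + 3..n}) (u ` {..d} \<union> {w} \<union> R)"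
  proof (intro bij_betw_combine)
    have "inj_on g {1..d + 1}"
    proof (rule inj_onI)
      fix i j assume "i \<in> {1..d + 1}" "j \<in> {1..d + 1}" "g i = g j"
      then show "i = j" using u_eq_iff[of "i - 1" "j - 1"] by (simp add: g_def) linarith
    qed
    moreover have "g ` {1..d + 1} = u ` {..d}"
    proof (intro equalityI subsetI)
      fix x assume "x \<in> u ` {..d}"
      then obtain k where "k \<le> d" "x = g (Suc k)" by (auto simp: g_def)
      then show "x \<in> g ` {1..d + 1}" by auto
    qed (auto simp: g_def)
    ultimately show "bij_betw g {1..d + 1} (u ` {..d})" by (simp add: bij_betw_def)
    show "bij_betw g {d + 2} {w}" by (simp add: bij_betw_def g_def)
    show "bij_betw g {d + 3..n} R"
      using \<beta> by (rule bij_betw_cong[THEN iffD1, rotated]) (simp add: g_def)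
  qed (use w_off in \<open>auto simp: R_def\<close>)
  moreover have "{1..d + 1} \<union> {d + 2} \<union> {d + 3..n} = gverts (U_graph n d)"
    using dn by (auto simp: gverts_U_graph)
  moreover have "u ` {..d} \<union> {w} \<union> R = gverts G"
    using path w_V by (auto simp: R_def)
  ultimately have bij: "bij_betw g (gverts (U_graph n d)) (gverts G)" by simp
  show ?thesis
  proof (rule gisoI_edges_subset[OF G simple_U_graph[OF d4 dn] bij])
    show "card (gedges G) \<le> card (gedges (U_graph n d))"
      by (simp add: card_E card_gedges_U_graph[OF d4 dn])
    fix a b assume "{a, b} \<in> gedges (U_graph n d)"
    then have "b \<in> nbrs (U_graph n d) a" by (simp add: nbrs_def)
    moreover have step: "{g a, g (a + 1)} \<in> gedges G" if "1 \<le> a" "a \<le> d" for a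
      using u_edge[of "a - 1"] that by (simp add: g_def)
    moreover have "g 2 = u 1" "g 4 = u 3" "g (d + 2) = w" using d4 by (simp_all add: g_def)
    moreover have pend: "{u 1, g j} \<in> gedges G" if "d + 3 \<le> j" "j \<le> n" for j
    proof -
      have "g j \<in> R" using that \<beta> by (auto simp: g_def bij_betw_def)
      then show ?thesis using R by (auto simp: nbrs_def)
    qed
    ultimately show "{g a, g b} \<in> gedges G"
     
        using wp wq assms unfolding mem_nbrs_U_graph by (elim disjE conjE) (simp_all add: insert_commute)
  qed
qed

text \<open>Reading the path backwards allows the assumption that the hub comes before the vertex of
  degree 3.\<close>

lemma reverse: "hub_graph G n d (\<lambda>k. u (d - k)) w (d - p) (d - q)"
proof
  show "inj_on (\<lambda>k. u (d - k)) {..d}"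
    by (auto simp: inj_on_def u_eq_iff)
  show "{u (d - k), u (d - Suc k)} \<in> gedges G" if "k < d" for k
    using u_edge[of "d - Suc k"] that by (simp add: insert_commute Suc_diff_Suc)
  show "b \<le> Suc a" if "a \<le> d" "b \<le> d" "{u (d - a), u (d - b)} \<in> gedges G" for a b
    using u_induced[of "d - b" "d - a"] that by (simp add: insert_commute)
  have "(\<lambda>k. d - k) ` {1..<d} = {1..<d}"
  proof (intro equalityI subsetI)
    fix k assume "k \<in> {1..<d}"
    then show "k \<in> (\<lambda>k. d - k) ` {1..<d}" by (intro image_eqI[of _ _ "d - k"]) auto
  qed auto
  then have "(\<lambda>k. u (d - k)) ` {1..<d} = u ` {1..<d}" by (metis image_image)
  then show "inner G = insert w ((\<lambda>k. u (d - k)) ` {1..<d})" by (simp add: inner_eq)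
  show "w \<notin> (\<lambda>k. u (d - k)) ` {..d}" using w_off by auto
qed (use G card_V card_E d4 dn deg1 u_V w_V wp wq p q pq deg_p deg_q deg_other in auto)

text \<open>Here the hub has degree \<open>n - d + 1 = 3\<close> as well, so the two roles are
  interchangeable.\<close>

lemma swap:
  assumes "n - d = 2"
  shows "hub_graph G n d u w q p"
proof
qed (use G card_V card_E d4 dn deg1 u_V u_inj u_edge u_induced w_V w_off inner_eq wp wq p q pq
    deg_p deg_q deg_other assms in auto)

text \<open>The hub and \<open>u q\<close> are one or two steps apart. Apart from these distances,
  what matters is whether the hub is next to the start of the path and \<open>u q\<close> next to
  its end, since end edges have no defect. In every position but two the path edges near the hub and
  \<open>u q\<close> have surplus enough.\<close>

lemma less_or_giso_if_hub_first:
  assumes "p < q"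
  shows "reduced_sombor G < reduced_sombor (U_graph n d) \<or> giso G (U_graph n d)"
proof -
  let ?N = "real (n - d)" and ?g = "\<lambda>a b. fd a b - fd 1 1"
    and ?f = "\<lambda>k. fd (exc k) (exc (Suc k)) - fd 1 1"
  have N: "2 \<le> ?N" using dn by simp
  have g21: "fd 1 1 < fd 2 1" by (rule fd_strict_mono) auto
  have gN1: "fd 2 1 \<le> fd ?N 1" using N by (intro fd_mono) auto
  have gN2: "fd ?N 1 < fd ?N 2" using fd_strict_mono[of 1 2 ?N] N by (simp add: fd_commute)
  \<comment> \<open>Used when the hub and \<open>u q\<close> are adjacent: the surplus of their edge
    exceeds that of a hub edge and of an edge at a vertex of degree 3 together.\<close>
  have key: "fd ?N 1 + fd 2 1 < fd ?N 2 + fd 1 1" by (rule fd_2_gt[OF N])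
  have c: "fd 1 ?N = fd ?N 1" "fd 1 2 = fd 2 1" by (rule fd_commute)+
  have "q = Suc p \<or> q = Suc (Suc p)" "p = 1 \<or> 1 < p" "Suc q < d \<or> Suc q = d"
    "2 < ?N \<or> n - d = 2"
    using assms pq(2) p q N by auto
  then consider "q = Suc p" "1 < p" "Suc q < d" | "q = Suc p" "1 < p" "Suc q = d" | "q = Suc p" "p = 1"
    | "q = Suc (Suc p)" "p = 1" | "q = Suc (Suc p)" "1 < p" "2 < ?N"
    | "q = Suc (Suc p)" "1 < p" "Suc q < d" | "q = Suc (Suc p)" "1 < p" "n - d = 2" "Suc q = d"
    by blast
  then have "reduced_sombor G < reduced_sombor (U_graph n d) \<or> p = 1 \<and> q = 3 \<or>
      p = d - 3 \<and> q = d - 1 \<and> n - d = 2"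
  proof cases
    case 1
    define r where "r = p - 1"
    have r: "p = Suc r" "1 \<le> r" using 1 by (auto simp: r_def)
    have "(\<Sum>k\<in>{r, Suc r, Suc (Suc r)}. ?f k) = ?g 1 ?N + ?g ?N 2 + ?g 2 1"
      using 1 r by (simp add: path_excess_def)
    then show ?thesis
      using 1 r gN2 gN1 g21 reduced_sombor_less[of "{r, Suc r, Suc (Suc r)}"]
      by (simp add: c)
  next
    case 2
    define r where "r = p - 1"
    have r: "p = Suc r" "1 \<le> r" using 2 by (auto simp: r_def)
    have "(\<Sum>k\<in>{r, Suc r}. ?f k) = ?g 1 ?N + ?g ?N 2"
      using 2 r by (simp add: path_excess_def)
    then show ?thesis
      using 2 r key gN1 g21 reduced_sombor_less[of "{r, Suc r}"] by (simp add: c)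
  next
    case 3
    \<comment> \<open>Position 0 is a leaf, so the edge before the hub gives nothing;
      \<open>4 \<le> d\<close> keeps position 3 among the inner ones.\<close>
    have "(\<Sum>k\<in>{1, 2}. ?f k) = ?g ?N 2 + ?g 2 1"
      using 3 by (simp add: path_excess_def numeral_2_eq_2)
    then show ?thesis
      using key g21 d4 reduced_sombor_less[of "{1, 2}"] by simp
  next
    case 4
    then show ?thesis by simp
  next
    case 5
    define r where "r = p - 1"
    have r: "p = Suc r" "1 \<le> r" using 5 by (auto simp: r_def)
    have "(\<Sum>k\<in>{r, Suc r, Suc (Suc r)}. ?f k) = 2 * ?g ?N 1 + ?g 2 1"
      using 5(1) r by (simp add: path_excess_def c)
    moreover have "fd 2 1 < fd ?N 1" using 5(3) by (intro fd_strict_mono) auto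
    ultimately show ?thesis
      using 5(1) r q reduced_sombor_less[of "{r, Suc r, Suc (Suc r)}"] by simp
  next
    case 6
    define r where "r = p - 1"
    have r: "p = Suc r" "1 \<le> r" using 6 by (auto simp: r_def)
    have "(\<Sum>k\<in>{r, Suc r, Suc (Suc r), Suc (Suc (Suc r))}. ?f k) = 2 * ?g ?N 1 + 2 * ?g 2 1"
      using 6(1) r by (simp add: path_excess_def c)
    then show ?thesis
      using 6 r g21 gN1 reduced_sombor_less[of "{r, Suc r, Suc (Suc r), Suc (Suc (Suc r))}"] by simp
  next
    case 7
    then show ?thesis by auto
  qed
  then show ?thesis
  proof (elim disjE conjE)
    assume "p = 1" "q = 3"
    then show ?thesis using giso_U_graph by simp
  next
    \<comment> \<open>The mirror image of the extremal graph with the two vertices of degree 3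
      exchanged: reversal gives the positions 3 and 1, and \<open>swap\<close> turns them into 1 and
      3.\<close>
    assume last: "p = d - 3" "q = d - 1" "n - d = 2"
    then have "d - q = 1" "d - p = 3" using d4 by auto
    then show ?thesis
      using hub_graph.giso_U_graph[OF hub_graph.swap[OF reverse last(3)]] by simp
  qed simp
qed

end

lemma hub_graph_less_or_giso:
  assumes "hub_graph G n d u w p q"
  shows "reduced_sombor G < reduced_sombor (U_graph n d) \<or> giso G (U_graph n d)"
proof (cases "p < q")
  case True
  then show ?thesis using hub_graph.less_or_giso_if_hub_first assms by metis
next
  case False
  then have "d - p < d - q" using hub_graph.p[OF assms] hub_graph.pq[OF assms] by auto
  then show ?thesis
    using hub_graph.less_or_giso_if_hub_first[OF hub_graph.reverse[OF assms]] by simp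
qed

section \<open>The upper bound\<close>

text \<open>The surpluses are below \<open>2 * (1 - 0.5857) + 3 * (0.764 - 0.5857) < 1.4\<close>,
  and \<open>1 - 1.4 = -0.4\<close>. Any constant above -1 would serve, because the competitors
  compared with this bound lose at least 1.\<close>

lemma reduced_sombor_U_graph_gt:
  assumes "4 \<le> d" "d + 2 \<le> n"
  shows "(real (n - d) - 1)\<^sup>2 - 0.4 + 3 * real (n - d) + 2 * real d - real d * fd 1 1
    < reduced_sombor (U_graph n d)"
proof -
  have "fd (real (n - d)) 1 < 1" using assms by (intro fd_1_less_1) simp
  moreover have "(if d = 4 then 2 else 3) * (fd 2 1 - fd 1 1) \<le> 3 * (fd 2 1 - fd 1 1)"
    using fd_mono[of 1 2 1 1] by (intro mult_right_mono) auto
  moreover have "0.5857 \<le> fd 1 1" "fd 2 1 \<le> 0.764"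
    using sqrt_2_bounds sqrt_5_bounds by (simp_all add: fd_1_1 fd_2_1)
  ultimately show ?thesis unfolding reduced_sombor_U_graph[OF assms] by (cases "d = 4") simp_all
qed

text \<open>A strict inequality outside the isomorphism class gives the bound and the hard half of
  the equality case at once.\<close>

lemma less_or_giso_if_unicyclic_class:
  fixes G :: "'a ugraph"
  assumes d4: "4 \<le> d" and dn: "d + 2 \<le> n" and U: "G \<in> unicyclic_class n d"
  shows "reduced_sombor G < reduced_sombor (U_graph n d) \<or> giso G (U_graph n d)"
proof -
  have uni: "unicyclic G" and card_V: "card (gverts G) = n" and diam: "gdiameter G = d"
    using U by (auto simp: unicyclic_class_def)
  have G: "simple_ugraph G" and con: "gconnected G"
    using uni by (auto simp: unicyclic_def)
  obtain C where "gcycle G C" using uni unfolding unicyclic_def by blast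
  then obtain S where S: "S \<noteq> {}" "finite S"
    and cyc: "\<And>v. v \<in> S \<Longrightarrow> \<exists>a\<in>S. \<exists>b\<in>S. a \<noteq> b \<and> {v, a} \<in> gedges G \<and> {v, b} \<in> gedges G"
    by (rule gcycle_vertices) blast
  have deg1: "1 \<le> gdegree G v" if "v \<in> gverts G" for v
    using gdegree_pos_if_gconnected[OF con G _ that] card_V dn by simp
  have m_le: "card (gedges G) \<le> n" using card_gedges_le_if_unicyclic[OF uni] card_V by simp
  obtain u \<phi> where u_V: "\<And>k. k \<le> d \<Longrightarrow> u k \<in> gverts G" and \<phi>: "\<And>k. k \<le> d \<Longrightarrow> \<phi> (u k) = k"
    and u_edge: "\<And>k. k < d \<Longrightarrow> {u k, u (Suc k)} \<in> gedges G"
    and lip: "\<And>a b. {a, b} \<in> gedges G \<Longrightarrow> \<phi> b \<le> Suc (\<phi> a)"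
    using diametral_path[OF con G diam] by metis
  have lip': "\<phi> a \<le> Suc (\<phi> b)" if "{a, b} \<in> gedges G" for a b
    using lip[of b a] that by (simp add: insert_commute)
  have u_inj: "inj_on u {..d}" using \<phi> by (intro inj_on_inverseI[of _ \<phi>]) simp
  have u_neq: "u a \<noteq> u b" if "a \<noteq> b" "a \<le> d" "b \<le> d" for a b
    using \<phi> that by metis
  have u_induced: "b \<le> Suc a" if "a \<le> d" "b \<le> d" "{u a, u b} \<in> gedges G" for a b
    using lip[OF that(3)] \<phi> that by simp
  have S_inner: "S \<subseteq> inner G"
  proof
    fix v assume "v \<in> S"
    then obtain a b where "a \<noteq> b" "{v, a} \<in> gedges G" "{v, b} \<in> gedges G" using cyc by blast
    then show "v \<in> inner G"
      using two_le_gdegree[OF G] simple_ugraph_edgeD[OF G] by (auto simp: inner_def)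
  qed
  \<comment> \<open>A cycle vertex with the largest \<phi> would have two cycle neighbours on the
    level just below, but the path has only one vertex on each level.\<close>
  have "\<not> S \<subseteq> u ` {..d}"
  proof
    assume sub: "S \<subseteq> u ` {..d}"
    have "Max (\<phi> ` S) \<in> \<phi> ` S" using S by (intro Max_in) auto
    then obtain v where v_S: "v \<in> S" and v_Max: "Max (\<phi> ` S) = \<phi> v" by (rule imageE) blast
    have v_max: "\<phi> x \<le> \<phi> v" if "x \<in> S" for x
      using that S(2) by (simp flip: v_Max)
    obtain a b where ab: "a \<in> S" "b \<in> S" "a \<noteq> b" "{v, a} \<in> gedges G" "{v, b} \<in> gedges G"
      using cyc[OF v_S] by blast
    have S_eq: "x = u (\<phi> x)" if x: "x \<in> S" for x
    proof -
      obtain k where "k \<le> d" "x = u k" using x sub by blast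
      then show ?thesis using \<phi> by simp
    qed
    have pred: "Suc (\<phi> x) = \<phi> v" if x: "x \<in> S" "{v, x} \<in> gedges G" for x
    proof -
      have "x \<noteq> v" using simple_ugraph_edgeD(3)[OF G x(2)] by simp
      then have "\<phi> x \<noteq> \<phi> v" using S_eq[OF x(1)] S_eq[OF v_S] by metis
      then show ?thesis using v_max[OF x(1)] lip'[OF x(2)] by linarith
    qed
    have "\<phi> a = \<phi> b" using pred[OF ab(1,4)] pred[OF ab(2,5)] by simp
    then show False using ab(3) S_eq[OF ab(1)] S_eq[OF ab(2)] by simp
  qed
  then obtain w where w: "w \<in> S" and w_off: "w \<notin> u ` {..d}" by blast
  have w_V: "w \<in> gverts G" using w S_inner by (auto simp: inner_def)
  let ?A = "insert w (u ` {1..<d})"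
  have A_inner: "?A \<subseteq> inner G"
  proof -
    have "u k \<in> inner G" if k: "1 \<le> k" "k < d" for k
    proof -
      have "{u k, u (k - 1)} \<in> gedges G"
        using u_edge[of "k - 1"] k by (simp add: insert_commute)
      moreover have "u (k - 1) \<noteq> u (Suc k)" using k by (intro u_neq) auto
      ultimately have "2 \<le> gdegree G (u k)" using two_le_gdegree[OF G _ u_edge] k by blast
      then show ?thesis using u_V k by (simp add: inner_def)
    qed
    then show ?thesis using w S_inner by auto
  qed
  have card_A: "card ?A = d"
  proof -
    have "inj_on u {1..<d}" using u_inj by (rule inj_on_subset) auto
    then have "card (u ` {1..<d}) = d - 1" by (simp add: card_image)
    moreover have "w \<notin> u ` {1..<d}" using w_off by auto
    ultimately show ?thesis using d4 by simp
  qed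
  have finI: "finite (inner G)" by (rule finite_inner[OF G deg1])
  have card_I: "d \<le> card (inner G)" using card_mono[OF finI A_inner] card_A by simp
  define s where "s = (\<Sum>v\<in>inner G. gdegree G v - 2)"
  define s2 where "s2 = (\<Sum>v\<in>inner G. (gdegree G v - 2)\<^sup>2)"
  have s: "real s = 2 * real (card (gedges G)) - real n - real (card (inner G))"
    using sum_inner_excess[OF G deg1] by (simp add: s_def card_V)
  have SO: "reduced_sombor G \<le> real s2 + 3 * real s + 2 * real (card (inner G))
      - fd 1 1 * (real (card (gedges G)) + real (card (inner G)) - real n)"
    using reduced_sombor_eq[OF G deg1] sum_defect_ge[OF G deg1, of "{}"]
    by (simp add: s s2_def card_V)
  note gt = reduced_sombor_U_graph_gt[OF d4 dn]
  have c: "0 < fd 1 1" "fd 1 1 < 1" unfolding fd_1_1 using sqrt_2_bounds by auto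
  show ?thesis
  proof (cases "card (gedges G) = n \<and> card (inner G) = d")
    case False
    \<comment> \<open>\<open>k\<close> counts the surplus non-leaves and \<open>t\<close> the
      missing edges. The excess sum is \<open>n - d - k - 2 * t\<close>, hence at most
      \<open>n - d - 1\<close>; compared with the leading terms of the extremal value the total loss
      is at least \<open>k + 5 * t\<close>, so at least 1.\<close>
    define k where "k = real (card (inner G)) - real d"
    define t where "t = real n - real (card (gedges G))"
    have kt: "0 \<le> k" "0 \<le> t" "1 \<le> k + t"
      using False card_I m_le by (auto simp: k_def t_def)
    have s_kt: "real s = real (n - d) - k - 2 * t" using s dn by (simp add: k_def t_def)
    have "s2 \<le> s\<^sup>2" unfolding s_def s2_def by (rule sum_squares_le_square_sum[OF finI])
    then have "real s2 \<le> (real s)\<^sup>2" by (metis of_nat_le_iff of_nat_power)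
    also have "\<dots> \<le> (real (n - d) - 1)\<^sup>2"
      using s_kt kt by (intro power_mono) auto
    finally have "real s2 \<le> (real (n - d) - 1)\<^sup>2" .
    moreover have "fd 1 1 * (real (card (gedges G)) + real (card (inner G)) - real n) =
        real d * fd 1 1 + k * fd 1 1 - t * fd 1 1"
      by (simp add: k_def t_def algebra_simps)
    moreover have "0 \<le> k * fd 1 1" "t * fd 1 1 \<le> t"
      using kt c by (simp_all add: mult_left_le)
    moreover have "real (card (inner G)) = real d + k" by (simp add: k_def)
    ultimately have "reduced_sombor G < reduced_sombor (U_graph n d)"
      using SO s_kt kt gt by linarith
    then show ?thesis ..
  next
    case True
    then have A_eq: "inner G = ?A" using card_seteq[OF finI A_inner] card_A by simp
    have s_eq: "s = n - d" using s True dn by linarith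
    obtain a b where ab: "a \<in> S" "b \<in> S" "a \<noteq> b" "{w, a} \<in> gedges G" "{w, b} \<in> gedges G"
      using cyc[OF w] by blast
    \<comment> \<open>Now the non-leaves are just \<open>w\<close> and the inner path vertices, so
      the cycle neighbours of \<open>w\<close> lie on the path.\<close>
    have on_path: "\<exists>i. x = u i \<and> 1 \<le> i \<and> i < d" if "x \<in> S" "{w, x} \<in> gedges G" for x
    proof -
      have "x \<in> u ` {1..<d}"
        using that S_inner[unfolded A_eq] simple_ugraph_edgeD(3)[OF G that(2)] by blast
      then show ?thesis by (auto simp del: One_nat_def)
    qed
    obtain i where i: "a = u i" "1 \<le> i" "i < d" using on_path[OF ab(1,4)] by blast
    obtain j where j: "b = u j" "1 \<le> j" "j < d" using on_path[OF ab(2,5)] by blast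
    \<comment> \<open>\<phi> takes the values \<open>i\<close> and \<open>j\<close> at the two
      neighbours, and both differ by at most 1 from its value at \<open>w\<close>.\<close>
    have ij: "i \<noteq> j" "j \<le> i + 2" "i \<le> j + 2"
    proof -
      show "i \<noteq> j" using ab(3) i(1) j(1) by blast
      have "\<phi> a = i" "\<phi> b = j" using \<phi>[of i] \<phi>[of j] i j by simp_all
      then show "j \<le> i + 2" "i \<le> j + 2"
        using lip[OF ab(4)] lip'[OF ab(4)] lip[OF ab(5)] lip'[OF ab(5)] by auto
    qed
    have deg3: "3 \<le> gdegree G (u k)" if k: "1 \<le> k" "k < d" "{w, u k} \<in> gedges G" for k
    proof -
      have "{u k, u (k - 1)} \<in> gedges G"
        using u_edge[of "k - 1"] k by (simp add: insert_commute)
      moreover have "u (k - 1) \<noteq> u (Suc k)" using k by (intro u_neq) auto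
      moreover have "u (k - 1) \<noteq> w" "u (Suc k) \<noteq> w" using w_off k by auto
      moreover have "{u k, w} \<in> gedges G" using k by (simp add: insert_commute)
      ultimately show ?thesis using three_le_gdegree[OF G _ u_edge] k by blast
    qed
    have degs: "3 \<le> gdegree G a" "3 \<le> gdegree G b"
      using deg3[OF i(2,3)] deg3[OF j(2,3)] ab(4,5) by (simp_all add: i(1) j(1))
    \<comment> \<open>Both neighbours have positive excess and the excesses sum to
      \<open>n - d\<close>. So either the squares fall short by 2, or the degrees are those required
      of a hub graph.\<close>
    have cases: "s2 + 2 \<le> (n - d - 1)\<^sup>2 + 1 \<or> s = n - d \<and>
        (gdegree G a - 2 = n - d - 1 \<and> gdegree G b - 2 = 1 \<or>
         gdegree G a - 2 = 1 \<and> gdegree G b - 2 = n - d - 1) \<and>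
        (\<forall>v\<in>inner G - {a, b}. gdegree G v - 2 = 0)"
      unfolding s_def s2_def
    proof (rule sum_squares_two_positive[OF finI])
      show "a \<in> inner G" "b \<in> inner G" "a \<noteq> b" using ab S_inner by auto
      show "1 \<le> gdegree G a - 2" "1 \<le> gdegree G b - 2"
        using degs by simp_all
      show "(\<Sum>v\<in>inner G. gdegree G v - 2) \<le> n - d" using s_eq by (simp add: s_def)
    qed
    have deg_other: "gdegree G v = 2"
      if "\<forall>v\<in>inner G - {a, b}. gdegree G v - 2 = 0" "v \<in> inner G - {u i, u j}" for v
    proof -
      have "gdegree G v - 2 = 0" using that i j by blast
      moreover have "2 \<le> gdegree G v" using that(2) by (simp add: inner_def)
      ultimately show ?thesis by simp
    qed
    have wi: "{w, u i} \<in> gedges G" and wj: "{w, u j} \<in> gedges G" using ab i j by auto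
    from cases show ?thesis
    proof (elim disjE conjE)
      \<comment> \<open>The sum of squares is at most \<open>(n - d - 1)^2 - 1\<close>, below the
        \<open>-0.4\<close> allowed by \<open>gt\<close>.\<close>
      assume "s2 + 2 \<le> (n - d - 1)\<^sup>2 + 1"
      then have "real (s2 + 2) \<le> real ((n - d - 1)\<^sup>2 + 1)" by (rule of_nat_mono)
      moreover have "real ((n - d - 1)\<^sup>2 + 1) = (real (n - d) - 1)\<^sup>2 + 1" using dn by simp
      ultimately have "real s2 \<le> (real (n - d) - 1)\<^sup>2 - 1" by simp
      then have "reduced_sombor G < reduced_sombor (U_graph n d)"
        using SO gt True s_eq by (simp add: mult.commute)
      then show ?thesis ..
    next
      assume *: "gdegree G a - 2 = n - d - 1" "gdegree G b - 2 = 1"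
        "\<forall>v\<in>inner G - {a, b}. gdegree G v - 2 = 0"
      have deg: "gdegree G (u i) = n - d + 1" "gdegree G (u j) = 3"
        using *(1,2) degs dn by (simp_all add: i(1) j(1))
      have "hub_graph G n d u w i j"
        using G card_V True d4 dn deg1 u_V u_inj u_edge u_induced w_V w_off A_eq wi wj i(2,3) j(2,3)
          ij deg deg_other[OF *(3)]
        by (intro hub_graph.intro) simp_all
      then show ?thesis by (rule hub_graph_less_or_giso)
    next
      assume *: "gdegree G a - 2 = 1" "gdegree G b - 2 = n - d - 1"
        "\<forall>v\<in>inner G - {a, b}. gdegree G v - 2 = 0"
      have deg: "gdegree G (u j) = n - d + 1" "gdegree G (u i) = 3"
        using *(1,2) degs dn by (simp_all add: i(1) j(1))
      have "hub_graph G n d u w j i"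
        using G card_V True d4 dn deg1 u_V u_inj u_edge u_induced w_V w_off A_eq wi wj i(2,3) j(2,3)
          ij deg deg_other[OF *(3)]
        by (intro hub_graph.intro) (simp_all add: insert_commute)
      then show ?thesis by (rule hub_graph_less_or_giso)
    qed
  qed
qed

theorem theorem2p2:
  fixes G :: "'a ugraph" and n d :: nat
  assumes "4 \<le> d" and "d + 2 \<le> n"
    and "G \<in> unicyclic_class n d"
  shows "reduced_sombor G \<le> reduced_sombor (U_graph n d) \<and>
         (reduced_sombor G = reduced_sombor (U_graph n d) \<longleftrightarrow> giso G (U_graph n d))"
proof -
  have "simple_ugraph G" using assms(3) by (simp add: unicyclic_class_def unicyclic_def)
  then have "giso G (U_graph n d) \<Longrightarrow> reduced_sombor G = reduced_sombor (U_graph n d)"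
    using reduced_sombor_giso simple_U_graph[OF assms(1,2)] by blast
  then show ?thesis using less_or_giso_if_unicyclic_class[OF assms] by fastforce
qed

end
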